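(* Assume that $\Gamma$ is finite and that $f_\gamma(\xi)=A_\gamma\xi$ for all $\xi\in\mathbb{R}^n$, with $A_\gamma\in\mathbb{R}^{n\times n}$, for every $\gamma\in\Gamma$. Let $\mathcal{T}$ be a family of forward complete trajectories of $\dot x=f(x,\sigma)=A_\sigma x$ such that $\sigma\in\mathcal{S}_d\cap\mathcal{S}_e$ for all $(x,\sigma)\in\mathcal{T}$. Suppose that there exist a family of positive definite matrices $\{P_\gamma,\gamma\in\Gamma\}\subset\mathbb{R}^{n\times n}$ and a family of matrices $\{C_\gamma,\gamma\in\Gamma\}$ such that 1. $P_\gamma A_\gamma+A_\gamma^TP_\gamma\le-C_\gamma^TC_\gamma$ for all $\gamma\in\Gamma$; 2. $v(t)=x^T(t)P_{\sigma(t)}x(t)$ is nonincreasing on $[0,\infty)$ for all $(x,\sigma)\in\mathcal{T}$; 3. for every $\gamma\in\Gamma$, $\mathcal{U}_\gamma$, the unobservable subspace of the pair $(C_\gamma,A_\gamma)$, coincides with $\ker(A_\gamma)$; 4. $\bigcap_{\gamma\in\Gamma}\ker(A_\gamma)=\{0\}$. Then $\mathcal{T}$ is globally asymptotically stable (GAS).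
   Context: A switching signal is a function $\sigma:\mathbb{R}\to\Gamma$ that is piecewise constant (at most finitely many jumps in each compact interval) and continuous from the right; $\Lambda(\sigma)$ is the set of times at which $\sigma$ has a jump. Here $\mathrm{dom}(f)=\mathbb{R}^n\times\Gamma$ and $f(\xi,\gamma)=f_\gamma(\xi)$. A solution of $\dot x=f(x,\sigma)$ corresponding to $\sigma$ is a locally absolutely continuous $x:I_x\to\mathbb{R}^n$, $I_x\subset\mathbb{R}$ a nonempty interval, with $\dot x(t)=f(x(t),\sigma(t))$ for almost all $t\in I_x$. Then $(x,\sigma)$ is called a trajectory; it is forward complete if $\mathbb{R}_{\ge0}\subset I_x$. $\mathcal{S}_d=\bigcup_{\tau_D>0}\mathcal{S}_d[\tau_D]$, where $\mathcal{S}_d[\tau_D]$ is the set of switching signals with $|t-t'|\ge\tau_D$ for all $t\ne t'$ in $\Lambda(\sigma)$. $\mathcal{S}_e=\bigcup_{T>0}\mathcal{S}_e[T]$, where $\mathcal{S}_e[T]$ is the set of switching signals $\sigma$ such that $\sigma^{-1}(\gamma)\cap[t_0,t_0+T]\ne\emptyset$ for every $t_0\ge0$ and every $\gamma\in\Gamma$. Positive definite matrices are symmetric; $\le$ between symmetric matrices is the usual (semidefinite) order; $C_\gamma$ has $n$ columns; the unobservable subspace of $(C,A)$ is $\bigcap_{k\ge0}\ker(CA^k)$. A class $\mathcal{K}_\infty$ function is $\alpha:[0,\infty)\to\mathbb{R}_{\ge0}$ strictly increasing, continuous, unbounded, with $\alpha(0)=0$. A family $\mathcal{T}$ of forward complete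 trajectories is GAS if there exists $\alpha$ of class $\mathcal{K}_\infty$ such that for all $(x,\sigma)\in\mathcal{T}$, $|x(t)|\le\alpha(|x(t_0)|)$ for all $t\ge t_0\ge0$, and moreover $\lim_{t\to+\infty}x(t)=0$ for all $(x,\sigma)\in\mathcal{T}$. *)

theory Defs
  imports "HOL-Analysis.Analysis"
begin

section \<open>Switching signals\<close>

text \<open>
  The index set carries no topology, so limits of switching signals are taken in the discrete
  sense: a signal is continuous (from the right) at a time iff it is constant near it
  (on some interval to the right of it).
\<close>

definition jump_times :: "(real \<Rightarrow> 'g) \<Rightarrow> real set" where
  "jump_times \<sigma> = {t. \<not> (\<forall>\<^sub>F s in at t. \<sigma> s = \<sigma> t)}"

definition switching_signals :: "'g set \<Rightarrow> (real \<Rightarrow> 'g) set" where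
  "switching_signals \<Gamma> = {\<sigma>. range \<sigma> \<subseteq> \<Gamma>
     \<and> (\<forall>a b. finite (jump_times \<sigma> \<inter> {a..b}))
     \<and> (\<forall>t. \<forall>\<^sub>F s in at_right t. \<sigma> s = \<sigma> t)}"

definition dwell_time_signals :: "'g set \<Rightarrow> real \<Rightarrow> (real \<Rightarrow> 'g) set" where
  "dwell_time_signals \<Gamma> \<tau> = {\<sigma> \<in> switching_signals \<Gamma>.
     \<forall>t\<in>jump_times \<sigma>. \<forall>t'\<in>jump_times \<sigma>. t \<noteq> t' \<longrightarrow> \<tau> \<le> \<bar>t - t'\<bar>}"

definition S_d :: "'g set \<Rightarrow> (real \<Rightarrow> 'g) set" where
  "S_d \<Gamma> = (\<Union>\<tau>\<in>{0<..}. dwell_time_signals \<Gamma> \<tau>)"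

definition ergodic_signals :: "'g set \<Rightarrow> real \<Rightarrow> (real \<Rightarrow> 'g) set" where
  "ergodic_signals \<Gamma> T = {\<sigma> \<in> switching_signals \<Gamma>.
     \<forall>t0\<ge>0. \<forall>\<gamma>\<in>\<Gamma>. \<sigma> -` {\<gamma>} \<inter> {t0..t0 + T} \<noteq> {}}"

definition S_e :: "'g set \<Rightarrow> (real \<Rightarrow> 'g) set" where
  "S_e \<Gamma> = (\<Union>T\<in>{0<..}. ergodic_signals \<Gamma> T)"

section \<open>Trajectories\<close>

definition abs_cont_on :: "real set \<Rightarrow> (real \<Rightarrow> 'a::real_normed_vector) \<Rightarrow> bool" where
  "abs_cont_on S f \<longleftrightarrow> (\<forall>\<epsilon>>0. \<exists>\<delta>>0. \<forall>(m::nat) a b.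
     (\<forall>i<m. a i \<le> b i \<and> {a i..b i} \<subseteq> S)
     \<and> disjoint_family_on (\<lambda>i. {a i<..<b i}) {..<m}
     \<and> (\<Sum>i<m. b i - a i) < \<delta>
     \<longrightarrow> (\<Sum>i<m. norm (f (b i) - f (a i))) < \<epsilon>)"

definition locally_abs_cont_on :: "real set \<Rightarrow> (real \<Rightarrow> 'a::real_normed_vector) \<Rightarrow> bool" where
  "locally_abs_cont_on S f \<longleftrightarrow> (\<forall>a b. {a..b} \<subseteq> S \<longrightarrow> abs_cont_on {a..b} f)"

text \<open>
  A trajectory is a triple \<open>(I, x, \<sigma>)\<close>, where \<open>I\<close> is the domain of the solution \<open>x\<close>;
  the values of the total function \<open>x\<close> outside \<open>I\<close> are irrelevant.
\<close>

type_synonym ('n, 'g) traj = "real set \<times> (real \<Rightarrow> real^'n) \<times> (real \<Rightarrow> 'g)"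

definition trajectories ::
  "'g set \<Rightarrow> (real^'n \<Rightarrow> 'g \<Rightarrow> real^'n) \<Rightarrow> ('n, 'g) traj set" where
  "trajectories \<Gamma> f = {(I, x, \<sigma>). \<sigma> \<in> switching_signals \<Gamma>
     \<and> is_interval I \<and> I \<noteq> {}
     \<and> locally_abs_cont_on I x
     \<and> (AE t in lebesgue. t \<in> I \<longrightarrow>
          (x has_vector_derivative f (x t) (\<sigma> t)) (at t within I))}"

definition forward_complete :: "('n, 'g) traj \<Rightarrow> bool" where
  "forward_complete = (\<lambda>(I, x, \<sigma>). {0..} \<subseteq> I)"

definition class_K_inf :: "(real \<Rightarrow> real) \<Rightarrow> bool" where
  "class_K_inf \<alpha> \<longleftrightarrow> \<alpha> ` {0..} \<subseteq> {0..} \<and> strict_mono_on {0..} \<alpha> \<and> continuous_on {0..} \<alpha>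
     \<and> \<not> bdd_above (\<alpha> ` {0..}) \<and> \<alpha> 0 = 0"

definition GAS :: "('n::finite, 'g) traj set \<Rightarrow> bool" where
  "GAS \<T> \<longleftrightarrow>
     (\<exists>\<alpha>. class_K_inf \<alpha> \<and>
        (\<forall>(I, x, \<sigma>)\<in>\<T>. \<forall>t0 t. 0 \<le> t0 \<and> t0 \<le> t \<longrightarrow> norm (x t) \<le> \<alpha> (norm (x t0))))
     \<and> (\<forall>(I, x, \<sigma>)\<in>\<T>. (x \<longlongrightarrow> 0) at_top)"

section \<open>Matrices\<close>

definition positive_definite :: "real^'n^'n \<Rightarrow> bool" where
  "positive_definite P \<longleftrightarrow> transpose P = P \<and> (\<forall>\<xi>. \<xi> \<noteq> 0 \<longrightarrow> 0 < \<xi> \<bullet> (P *v \<xi>))"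

definition positive_semidefinite :: "real^'n^'n \<Rightarrow> bool" where
  "positive_semidefinite P \<longleftrightarrow> transpose P = P \<and> (\<forall>\<xi>. 0 \<le> \<xi> \<bullet> (P *v \<xi>))"

text \<open>The library's \<open>\<le>\<close> on vectors and matrices is componentwise, so the semidefinite order
  needs its own symbol.\<close>

definition semidefinite_le :: "real^'n^'n \<Rightarrow> real^'n^'n \<Rightarrow> bool" (infix \<open>\<preceq>\<close> 50) where
  "M \<preceq> N \<longleftrightarrow> positive_semidefinite (N - M)"

definition ker :: "real^'n^'m \<Rightarrow> (real^'n) set" where
  "ker M = {\<xi>. M *v \<xi> = 0}"

text \<open>The library's power \<open>^\<close> on \<open>real^'n^'n\<close> is componentwise as well.\<close>

primrec mat_power :: "real^'n^'n \<Rightarrow> nat \<Rightarrow> real^'n^'n" where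
  "mat_power A 0 = mat 1"
| "mat_power A (Suc k) = A ** mat_power A k"

text \<open>
  The number of rows of the output matrices may vary with the mode, which the type
  \<open>real^'n^'m\<close> does not allow. A real matrix with \<open>n\<close> columns and an arbitrary finite number of
  rows is therefore given as the list of its rows.
\<close>

type_synonym 'n row_matrix = "(real^'n) list"

text \<open>The Gram matrix \<open>C\<^sup>T C\<close>:\<close>

definition gram :: "'n row_matrix \<Rightarrow> real^'n^'n" where
  "gram C = (\<chi> i j. \<Sum>r\<leftarrow>C. r $ i * r $ j)"

definition rows_mult :: "'n row_matrix \<Rightarrow> real^'n^'n \<Rightarrow> 'n::finite row_matrix" where
  "rows_mult C M = map (\<lambda>r. r v* M) C"

definition rows_ker :: "'n::finite row_matrix \<Rightarrow> (real^'n) set" where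
  "rows_ker C = {\<xi>. \<forall>r\<in>set C. r \<bullet> \<xi> = 0}"

definition unobservable_subspace :: "'n::finite row_matrix \<Rightarrow> real^'n^'n \<Rightarrow> (real^'n) set" where
  "unobservable_subspace C A = (\<Inter>k. rows_ker (rows_mult C (mat_power A k)))"

end

theory Submission
  imports Defs
begin

text \<open>
  The bound on \<open>x\<close> comes from the monotonicity of \<open>v\<close> and uniform bounds for the forms \<open>P \<gamma>\<close>.
  For convergence, on an interval of length \<open>h\<close> where \<open>\<sigma> = \<gamma>\<close>, the drop of \<open>v\<close> is at least a
  positive semidefinite quadratic form in the state at the start of the interval whose null space
  lies in the unobservable subspace, that is in \<open>ker (A \<gamma>)\<close>. In finite dimension it therefore
  dominates \<open>|A \<gamma> x|\<^sup>2\<close>. As \<open>v\<close> converges, its drops tend to 0, and since every time lies in such an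
  interval by the dwell time, \<open>A (\<sigma> t) (x t)\<close>, the velocity of \<open>x\<close>, tends to 0. Hence \<open>x\<close> changes
  little over a time span \<open>T\<close> in which every mode is visited, so \<open>A \<gamma> (x t) \<longlongrightarrow> 0\<close> for all modes \<open>\<gamma>\<close>
  simultaneously, and the trivial intersection of the kernels gives \<open>x t \<longlongrightarrow> 0\<close>.
\<close>

section \<open>Absolutely continuous functions\<close>

text \<open>Outer regularity of Lebesgue measure; since \<open>N\<close> is null, \<open>U\<close>
  and \<open>U - N\<close> have the same measure.\<close>

lemma negligible_outer_open:
  fixes N :: "'a::euclidean_space set"
  assumes "negligible N" "e > 0"
  obtains U where "open U" "N \<subseteq> U" "U \<in> lmeasurable" "measure lebesgue U < e"
proof -
  have N: "N \<in> null_sets lebesgue"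
    using assms negligible_iff_null_sets by blast
  then have Ns: "N \<in> sets lebesgue" by auto
  obtain U where U: "open U" "N \<subseteq> U" "U - N \<in> lmeasurable" "emeasure lebesgue (U - N) < ennreal e"
    using sets_lebesgue_outer_open[OF Ns \<open>e > 0\<close>] by blast
  have Us: "U \<in> sets lebesgue" using U(1) by (simp add: borel_open sets_completionI_sets)
  have eq: "emeasure lebesgue (U - N) = emeasure lebesgue U"
    by (rule emeasure_Diff_null_set[OF N Us])
  have "U \<in> lmeasurable"
    using U(4) eq Us by (intro fmeasurableI) (auto simp: less_top[symmetric] intro: less_trans)
  moreover have "measure lebesgue U < e"
    using U(4) eq \<open>e > 0\<close> \<open>U \<in> lmeasurable\<close>
    by (metis emeasure_eq_measure2 ennreal_less_iff measure_nonneg)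
  ultimately show ?thesis using U that by blast
qed

text \<open>The definition of absolute continuity, carried over from indexed families to the finite
  sets of tagged intervals that occur in tagged divisions: an enumeration of \<open>p\<close>
  supplies the indices, and \<open>Inf K\<close>, \<open>Sup K\<close> recover the
  endpoints.\<close>

lemma abs_cont_on_sum_le:
  assumes ac: "abs_cont_on S f" and "e > 0"
  obtains d where "d > 0"
    "\<And>p. \<lbrakk>finite p; \<And>t K. (t, K) \<in> p \<Longrightarrow> K \<subseteq> S \<and> (\<exists>u v. u \<le> v \<and> K = {u..v});
        \<And>t K t' K'. \<lbrakk>(t, K) \<in> p; (t', K') \<in> p; (t, K) \<noteq> (t', K')\<rbrakk> \<Longrightarrow> interior K \<inter> interior K' = {};
        (\<Sum>(t, K)\<in>p. Sup K - Inf K) < d\<rbrakk>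
      \<Longrightarrow> (\<Sum>(t, K)\<in>p. norm (f (Sup K) - f (Inf K))) < e"
proof -
  obtain d where "d > 0" and d: "\<And>(m::nat) a b. \<lbrakk>\<And>i. i < m \<Longrightarrow> a i \<le> b i \<and> {a i..b i} \<subseteq> S;
     disjoint_family_on (\<lambda>i. {a i<..<b i}) {..<m}; (\<Sum>i<m. b i - a i) < d\<rbrakk>
     \<Longrightarrow> (\<Sum>i<m. norm (f (b i) - f (a i))) < e"
  proof -
    have "\<exists>d>0. \<forall>(m::nat) a b. (\<forall>i<m. a i \<le> b i \<and> {a i..b i} \<subseteq> S)
        \<and> disjoint_family_on (\<lambda>i. {a i<..<b i}) {..<m} \<and> (\<Sum>i<m. b i - a i) < d
        \<longrightarrow> (\<Sum>i<m. norm (f (b i) - f (a i))) < e"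
      using ac \<open>e > 0\<close> unfolding abs_cont_on_def by (elim allE impE)
    then show thesis
      by (elim exE conjE) (rule that, assumption, simp)
  qed
  show ?thesis
  proof (rule that[OF \<open>d > 0\<close>])
    fix p :: "('b \<times> real set) set"
    assume fin: "finite p"
      and iv: "\<And>t K. (t, K) \<in> p \<Longrightarrow> K \<subseteq> S \<and> (\<exists>u v. u \<le> v \<and> K = {u..v})"
      and dis: "\<And>t K t' K'. \<lbrakk>(t, K) \<in> p; (t', K') \<in> p; (t, K) \<noteq> (t', K')\<rbrakk> \<Longrightarrow> interior K \<inter> interior K' = {}"
      and len: "(\<Sum>(t, K)\<in>p. Sup K - Inf K) < d"
    obtain h where h: "bij_betw h {..<card p} p"
      using ex_bij_betw_nat_finite[OF fin] by (auto simp: atLeast0LessThan)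
    define a b where "a i = Inf (snd (h i))" and "b i = Sup (snd (h i))" for i
    have hp: "h i \<in> p" if "i < card p" for i
      using h that by (auto simp: bij_betw_def)
    have K: "a i \<le> b i \<and> snd (h i) = {a i..b i} \<and> snd (h i) \<subseteq> S" if i: "i < card p" for i
    proof -
      obtain u v where "u \<le> v" "snd (h i) = {u..v}" "snd (h i) \<subseteq> S"
        using iv[of "fst (h i)" "snd (h i)"] hp[OF i] by auto
      then show ?thesis by (auto simp: a_def b_def)
    qed
    have re: "(\<Sum>i<card p. g (h i)) = sum g p" for g :: "'b \<times> real set \<Rightarrow> real"
      by (rule sum.reindex_bij_betw[OF h])
    have "(\<Sum>i<card p. norm (f (b i) - f (a i))) < e"
    proof (rule d)
      show "a i \<le> b i \<and> {a i..b i} \<subseteq> S" if "i < card p" for i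
        using K[OF that] by auto
      show "disjoint_family_on (\<lambda>i. {a i<..<b i}) {..<card p}"
        unfolding disjoint_family_on_def
      proof (intro ballI impI)
        fix i j assume ij: "i \<in> {..<card p}" "j \<in> {..<card p}" "i \<noteq> j"
        then have "h i \<noteq> h j" using h by (auto simp: bij_betw_def inj_on_def)
        then have "interior (snd (h i)) \<inter> interior (snd (h j)) = {}"
          using dis[of "fst (h i)" "snd (h i)" "fst (h j)" "snd (h j)"] hp ij by auto
        then show "{a i<..<b i} \<inter> {a j<..<b j} = {}"
          using K[of i] K[of j] ij by (metis interior_atLeastAtMost_real lessThan_iff)
      qed
      show "(\<Sum>i<card p. b i - a i) < d"
        using len re[of "\<lambda>(t, K). Sup K - Inf K"] by (simp add: a_def b_def case_prod_beta)
    qed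
    then show "(\<Sum>(t, K)\<in>p. norm (f (Sup K) - f (Inf K))) < e"
      using re[of "\<lambda>(t, K). norm (f (Sup K) - f (Inf K))"] by (simp add: a_def b_def case_prod_beta)
  qed
qed

text \<open>Passing to interiors keeps the lengths and makes the intervals disjoint, so additivity
  and then monotonicity of the measure apply.\<close>

lemma sum_length_le_measure:
  assumes "finite p" and iv: "\<And>t K. (t, K) \<in> p \<Longrightarrow> K \<subseteq> U \<and> (\<exists>u v. u \<le> v \<and> K = {u..v::real})"
    and dis: "\<And>t K t' K'. \<lbrakk>(t, K) \<in> p; (t', K') \<in> p; (t, K) \<noteq> (t', K')\<rbrakk> \<Longrightarrow> interior K \<inter> interior K' = {}"
    and U: "U \<in> lmeasurable"
  shows "(\<Sum>(t, K)\<in>p. Sup K - Inf K) \<le> measure lebesgue U"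
proof -
  have len: "measure lebesgue (interior (snd z)) = Sup (snd z) - Inf (snd z)" if z: "z \<in> p" for z
  proof -
    obtain u v where "u \<le> v" "snd z = {u..v}"
      using iv[of "fst z" "snd z"] z by auto
    then show ?thesis by (auto simp: interior_atLeastAtMost_real)
  qed
  have fm: "interior (snd z) \<in> lmeasurable" if z: "z \<in> p" for z
  proof -
    obtain u v where "u \<le> v" "snd z = {u..v}"
      using iv[of "fst z" "snd z"] z by auto
    then show ?thesis by (auto simp: interior_atLeastAtMost_real)
  qed
  have "(\<Sum>(t, K)\<in>p. Sup K - Inf K) = (\<Sum>z\<in>p. measure lebesgue (interior (snd z)))"
    by (rule sum.cong) (use len in force)+
  also have "\<dots> = measure lebesgue (\<Union>z\<in>p. interior (snd z))"
  proof (rule measure_finite_Union[symmetric])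
    show "disjoint_family_on (\<lambda>z. interior (snd z)) p"
      unfolding disjoint_family_on_def using dis by (metis prod.collapse)
    show "emeasure lebesgue (interior (snd z)) \<noteq> \<infinity>" if "z \<in> p" for z
      using fm[OF that] by (simp add: fmeasurable_def)
  qed (use fm assms in auto)
  also have "\<dots> \<le> measure lebesgue U"
  proof (rule measure_mono_fmeasurable)
    show "(\<Union>z\<in>p. interior (snd z)) \<subseteq> U"
      using iv interior_subset by fastforce
    show "(\<Union>z\<in>p. interior (snd z)) \<in> sets lebesgue"
      using fm assms by (intro sets.finite_UN) auto
  qed (use U in auto)
  finally show ?thesis .
qed

text \<open>In a fine tagged division, the intervals tagged outside \<open>N\<close> are controlled by
  differentiability, and those tagged in \<open>N\<close>, of small total length, by absolute continuity.\<close>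

lemma abs_cont_on_deriv_bound:
  fixes f :: "real \<Rightarrow> 'a::real_normed_vector"
  assumes ac: "abs_cont_on {a..b} f" and ab: "a \<le> b" and N: "negligible N"
    and f': "\<And>t. \<lbrakk>t \<in> {a..b}; t \<notin> N\<rbrakk> \<Longrightarrow> (f has_vector_derivative f' t) (at t within {a..b})"
    and B: "\<And>t. \<lbrakk>t \<in> {a..b}; t \<notin> N\<rbrakk> \<Longrightarrow> norm (f' t - c) \<le> B"
    and B0: "0 \<le> B"
  shows "norm (f b - f a - (b - a) *\<^sub>R c) \<le> B * (b - a)"
proof -
  \<comment> \<open>The error has three sources: \<open>e * (b - a)\<close> from the difference
    quotients at tags outside \<open>N\<close>, \<open>e\<close> from the increments of
    \<open>f\<close> on intervals tagged in \<open>N\<close>, and \<open>e * norm c\<close> from the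
    total length of the latter.\<close>
  have "norm (f b - f a - (b - a) *\<^sub>R c) \<le> B * (b - a) + e * ((b - a) + 1 + norm c)" if "e > 0" for e :: real
  proof (rule abs_cont_on_sum_le[OF ac \<open>e > 0\<close>])
    fix d :: real
    assume "d > 0" and d: "\<And>p::(real \<times> real set) set. \<lbrakk>finite p;
        \<And>t K. (t, K) \<in> p \<Longrightarrow> K \<subseteq> {a..b} \<and> (\<exists>u v. u \<le> v \<and> K = {u..v});
        \<And>t K t' K'. \<lbrakk>(t, K) \<in> p; (t', K') \<in> p; (t, K) \<noteq> (t', K')\<rbrakk> \<Longrightarrow> interior K \<inter> interior K' = {};
        (\<Sum>(t, K)\<in>p. Sup K - Inf K) < d\<rbrakk>
      \<Longrightarrow> (\<Sum>(t, K)\<in>p. norm (f (Sup K) - f (Inf K))) < e"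
    \<comment> \<open>Measure below \<open>d\<close> triggers absolute continuity; measure below
      \<open>e\<close> controls the multiples of \<open>c\<close>.\<close>
    obtain U where U: "open U" "N \<subseteq> U" "U \<in> lmeasurable" "measure lebesgue U < min d e"
      using negligible_outer_open[OF N, of "min d e"] \<open>d > 0\<close> \<open>e > 0\<close> by auto
    have "\<exists>r>0. \<forall>y\<in>{a..b}. \<bar>y - t\<bar> < r \<longrightarrow> norm (f y - f t - (y - t) *\<^sub>R f' t) \<le> e * \<bar>y - t\<bar>"
      if "t \<in> {a..b}" "t \<notin> N" for t
      using f'[OF that] \<open>e > 0\<close> unfolding has_vector_derivative_def has_derivative_within_alt by auto
    then obtain r where r: "\<And>t. \<lbrakk>t \<in> {a..b}; t \<notin> N\<rbrakk> \<Longrightarrow> r t > 0"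
      "\<And>t y. \<lbrakk>t \<in> {a..b}; t \<notin> N; y \<in> {a..b}; \<bar>y - t\<bar> < r t\<rbrakk>
        \<Longrightarrow> norm (f y - f t - (y - t) *\<^sub>R f' t) \<le> e * \<bar>y - t\<bar>"
      by metis
    \<comment> \<open>Intervals tagged in \<open>N\<close> are forced into \<open>U\<close>. The
      unit ball is a default that only makes \<open>g\<close> a gauge on the whole line, since all
      tags lie in \<open>{a..b}\<close>.\<close>
    define g where "g t = (if t \<in> N then U else if t \<in> {a..b} then ball t (r t) else ball t 1)" for t
    have "gauge g"
      unfolding gauge_def g_def using U r by auto
    then obtain p where p: "p tagged_division_of {a..b}" "g fine p"
      by (rule fine_division_exists_real)
    note pD = tagged_division_ofD[OF p(1)]
    have iv: "K \<subseteq> {a..b} \<and> t \<in> {a..b} \<and> t \<in> K \<and> K \<subseteq> g t \<and> K = {Inf K..Sup K} \<and> Inf K \<le> Sup K"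
      if tK: "(t, K) \<in> p" for t K
    proof -
      obtain u v where uv: "K = {u..v}" using pD(4)[OF tK] by auto
      then have "u \<le> v" using pD(2)[OF tK] by auto
      then show ?thesis using uv pD(2,3)[OF tK] p(2) tK by (auto simp: fine_def)
    qed
    define q where "q = {z \<in> p. fst z \<in> N}"
    have qp: "q \<subseteq> p" and finp: "finite p" and finq: "finite q"
      using pD(1) by (auto simp: q_def)
    define F where "F = (\<lambda>(t::real, K). f (Sup K) - f (Inf K) - (Sup K - Inf K) *\<^sub>R c)"
    define l where "l = (\<lambda>(t::real, K::real set). Sup K - Inf K)"
    have l0: "l z \<ge> 0" if "z \<in> p" for z
      using iv[of "fst z" "snd z"] that by (auto simp: l_def case_prod_beta)
    have suml: "sum l p = b - a"
      using additive_tagged_division_1[OF ab p(1), of "\<lambda>x. x"] by (simp add: l_def)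
    have sumF: "sum F p = f b - f a - (b - a) *\<^sub>R c"
      using additive_tagged_division_1[OF ab p(1), of "\<lambda>x. f x - x *\<^sub>R c"]
      by (simp add: F_def algebra_simps case_prod_beta)
    have q1: "K \<subseteq> {a..b} \<and> (\<exists>u v. u \<le> v \<and> K = {u..v})" "K \<subseteq> U \<and> (\<exists>u v. u \<le> v \<and> K = {u..v})"
      if "(t, K) \<in> q" for t K
      using iv[of t K] that by (auto simp: q_def g_def)
    have q2: "interior K \<inter> interior K' = {}"
      if "(t, K) \<in> q" "(t', K') \<in> q" "(t, K) \<noteq> (t', K')" for t K t' K'
      using pD(5) that qp by blast
    have lq: "sum l q < min d e"
    proof -
      have "sum l q \<le> measure lebesgue U"
        unfolding l_def by (rule sum_length_le_measure[OF finq _ _ U(3)]) (rule q1(2), assumption, rule q2)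
      then show ?thesis using U(4) by simp
    qed
    then have fq: "(\<Sum>(t, K)\<in>q. norm (f (Sup K) - f (Inf K))) < e"
      by (intro d[OF finq]) (rule q1(1), assumption, rule q2, auto simp: l_def)
    have bad: "(\<Sum>z\<in>q. norm (F z)) \<le> e + e * norm c"
    proof -
      have "(\<Sum>z\<in>q. norm (F z)) \<le> (\<Sum>z\<in>q. (case z of (t, K) \<Rightarrow> norm (f (Sup K) - f (Inf K))) + l z * norm c)"
      proof (rule sum_mono)
        fix z assume "z \<in> q"
        then show "norm (F z) \<le> (case z of (t, K) \<Rightarrow> norm (f (Sup K) - f (Inf K))) + l z * norm c"
          using l0[of z] qp norm_triangle_ineq4[of "f (Sup (snd z)) - f (Inf (snd z))" "l z *\<^sub>R c"]
          by (auto simp: F_def l_def case_prod_beta)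
      qed
      also have "\<dots> = (\<Sum>(t, K)\<in>q. norm (f (Sup K) - f (Inf K))) + sum l q * norm c"
        by (simp add: sum.distrib sum_distrib_right)
      also have "\<dots> \<le> e + e * norm c"
        using fq lq by (intro add_mono mult_right_mono) auto
      finally show ?thesis .
    qed
    have good: "norm (F z) \<le> (B + e) * l z" if z: "z \<in> p - q" for z
    proof -
      obtain t K where zt: "z = (t, K)" by (cases z)
      define u v where "u = Inf K" and "v = Sup K"
      have tK: "(t, K) \<in> p" "t \<notin> N" using z zt by (auto simp: q_def)
      have K: "K = {u..v}" "u \<le> v" "t \<in> K" "K \<subseteq> {a..b}" "t \<in> {a..b}" "K \<subseteq> ball t (r t)"
        using iv[OF tK(1)] tK(2) by (auto simp: u_def v_def g_def)
      then have uvK: "u \<in> K" "v \<in> K" by auto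
      with K have uv: "u \<le> t" "t \<le> v" "u \<in> {a..b}" "v \<in> {a..b}" by auto
      have "u \<in> ball t (r t)" "v \<in> ball t (r t)" using uvK K(6) by blast+
      then have "\<bar>u - t\<bar> < r t" "\<bar>v - t\<bar> < r t" by (auto simp: dist_real_def)
      then have fu: "norm (f u - f t - (u - t) *\<^sub>R f' t) \<le> e * (t - u)"
        and fv: "norm (f v - f t - (v - t) *\<^sub>R f' t) \<le> e * (v - t)"
        using r(2)[of t u] r(2)[of t v] K(5) uv tK by auto
      \<comment> \<open>The increment is split at the tag \<open>t\<close>, so that the derivative
        at \<open>t\<close> serves both halves.\<close>
      have "F z = (f v - f t - (v - t) *\<^sub>R f' t) - (f u - f t - (u - t) *\<^sub>R f' t) + (v - u) *\<^sub>R (f' t - c)"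
        by (simp add: F_def zt u_def v_def algebra_simps)
      also have "norm \<dots> \<le> e * (v - t) + e * (t - u) + (v - u) * B"
      proof -
        have "norm ((v - u) *\<^sub>R (f' t - c)) \<le> (v - u) * B"
          using B[OF K(5) tK(2)] K(2) by (simp add: mult_left_mono)
        then show ?thesis
          using fu fv by (intro norm_triangle_le[OF add_mono[OF norm_triangle_le_diff[OF add_mono]]])
      qed
      also have "\<dots> = (B + e) * l z"
        by (simp add: zt l_def u_def v_def algebra_simps)
      finally show ?thesis .
    qed
    have "norm (sum F p) \<le> (\<Sum>z\<in>p. norm (F z))" by (rule norm_sum)
    also have "\<dots> = (\<Sum>z\<in>p - q. norm (F z)) + (\<Sum>z\<in>q. norm (F z))"
      by (rule sum.subset_diff[OF qp finp])
    also have "(\<Sum>z\<in>p - q. norm (F z)) \<le> (\<Sum>z\<in>p - q. (B + e) * l z)"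
      by (rule sum_mono[OF good])
    also have "\<dots> \<le> (\<Sum>z\<in>p. (B + e) * l z)"
      using l0 finp B0 \<open>e > 0\<close> by (intro sum_mono2) auto
    also have "\<dots> = (B + e) * (b - a)"
      by (simp add: suml[symmetric] sum_distrib_left)
    finally show ?thesis
      using bad by (simp add: sumF algebra_simps)
  qed
  then have approx: "norm (f b - f a - (b - a) *\<^sub>R c) \<le> B * (b - a) + e * ((b - a) + 1 + norm c)"
    if "e > 0" for e
    using that by blast
  \<comment> \<open>The factor of \<open>e\<close> does not depend on \<open>e\<close>, so rescaling
    removes it.\<close>
  have *: "norm (f b - f a - (b - a) *\<^sub>R c) \<le> B * (b - a) + e" if "e > 0" for e
  proof -
    have pos: "(b - a) + 1 + norm c > 0" using ab by (simp add: add_nonneg_pos add_pos_nonneg)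
    show ?thesis
      using approx[of "e / ((b - a) + 1 + norm c)"] pos \<open>e > 0\<close> by simp
  qed
  show ?thesis
    by (rule field_le_epsilon) (rule *)
qed

lemma abs_cont_on_imp_continuous:
  fixes f :: "real \<Rightarrow> 'a::real_normed_vector"
  assumes "abs_cont_on {a..b} f"
  shows "continuous_on {a..b} f"
  unfolding continuous_on_iff
proof (intro ballI allI impI)
  fix t e :: real assume t: "t \<in> {a..b}" and "e > 0"
  then have "\<exists>d>0. \<forall>(m::nat) u v. (\<forall>i<m. u i \<le> v i \<and> {u i..v i} \<subseteq> {a..b})
      \<and> disjoint_family_on (\<lambda>i. {u i<..<v i}) {..<m} \<and> (\<Sum>i<m. v i - u i) < d
      \<longrightarrow> (\<Sum>i<m. norm (f (v i) - f (u i))) < e"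
    using assms unfolding abs_cont_on_def by (elim allE impE)
  then obtain d where "d > 0" and d: "\<forall>(m::nat) u v. (\<forall>i<m. u i \<le> v i \<and> {u i..v i} \<subseteq> {a..b})
      \<and> disjoint_family_on (\<lambda>i. {u i<..<v i}) {..<m} \<and> (\<Sum>i<m. v i - u i) < d
      \<longrightarrow> (\<Sum>i<m. norm (f (v i) - f (u i))) < e"
    by (elim exE conjE) (rule that)
  \<comment> \<open>A family consisting of one interval.\<close>
  have *: "norm (f v - f u) < e" if "u \<le> v" "v - u < d" "u \<in> {a..b}" "v \<in> {a..b}" for u v
    using d[rule_format, of "Suc 0" "\<lambda>_. u" "\<lambda>_. v"] that by (auto simp: disjoint_family_on_def)
  show "\<exists>d>0. \<forall>s\<in>{a..b}. dist s t < d \<longrightarrow> dist (f s) (f t) < e"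
  proof (intro exI[of _ d] conjI ballI impI)
    fix s assume "s \<in> {a..b}" "dist s t < d"
    then show "dist (f s) (f t) < e"
      using *[of s t] *[of t s] t by (cases "s \<le> t") (auto simp: dist_norm norm_minus_commute)
  qed (rule \<open>d > 0\<close>)
qed

lemma abs_cont_on_subset: "abs_cont_on S f \<Longrightarrow> T \<subseteq> S \<Longrightarrow> abs_cont_on T f"
  unfolding abs_cont_on_def
  by (elim all_forward imp_forward ex_forward conj_forward) (blast intro: order.trans)+

section \<open>Quadratic forms\<close>

text \<open>The null set \<open>N\<close> of a nonnegative quadratic form is a subspace, and neither
  the form nor \<open>h\<close> changes when an element of \<open>N\<close> is added. It remains to
  compare the two on the orthogonal complement of \<open>N\<close>, where compactness of the unit
  sphere gives the form a positive lower bound. As \<open>g\<close> need not be self-adjoint, the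
  polar form is the symmetrised sum.\<close>

lemma psd_form_dominates:
  fixes g :: "'a::euclidean_space \<Rightarrow> 'a" and h :: "'a \<Rightarrow> 'b::real_normed_vector"
  assumes g: "linear g" and h: "linear h"
    and nonneg: "\<And>x. 0 \<le> x \<bullet> g x"
    and null: "\<And>x. x \<bullet> g x = 0 \<Longrightarrow> h x = 0"
  shows "\<exists>K\<ge>0. \<forall>x. (norm (h x))\<^sup>2 \<le> K * (x \<bullet> g x)"
proof -
  interpret g: linear g by fact
  interpret h: linear h by fact
  define N where "N = {x. x \<bullet> g x = 0}"
  have polar: "x \<bullet> g y + y \<bullet> g x = 0" if "x \<in> N" for x y
  proof (rule ccontr)
    define G where "G = x \<bullet> g y + y \<bullet> g x"
    assume "x \<bullet> g y + y \<bullet> g x \<noteq> 0"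
    then have "G \<noteq> 0" by (simp add: G_def)
    \<comment> \<open>The form is affine in \<open>s\<close> along \<open>y + s *\<^sub>R x\<close>;
      this \<open>s\<close> gives it the value -1.\<close>
    define s where "s = - (y \<bullet> g y + 1) / G"
    have "0 \<le> (y + s *\<^sub>R x) \<bullet> g (y + s *\<^sub>R x)" by (rule nonneg)
    also have "\<dots> = y \<bullet> g y + s * G"
      using that by (simp add: N_def G_def g.add g.scale algebra_simps)
    also have "\<dots> = -1" using \<open>G \<noteq> 0\<close> by (simp add: s_def)
    finally show False by simp
  qed
  have q_add: "(x + y) \<bullet> g (x + y) = y \<bullet> g y" if "x \<in> N" for x y
  proof -
    have "(x + y) \<bullet> g (x + y) = x \<bullet> g x + y \<bullet> g y + (x \<bullet> g y + y \<bullet> g x)"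
      by (simp add: g.add algebra_simps)
    then show ?thesis using polar[OF that, of y] that by (simp add: N_def)
  qed
  have N: "subspace N"
  proof (rule subspaceI)
    show "x + y \<in> N" if "x \<in> N" "y \<in> N" for x y
      using q_add[OF that(1), of y] that by (simp add: N_def)
  qed (auto simp: N_def g.scale)
  define S where "S = sphere 0 1 \<inter> {x. \<forall>n\<in>N. orthogonal x n}"
  have "closed {x. \<forall>n\<in>N. orthogonal x n}"
  proof -
    have "{x. \<forall>n\<in>N. orthogonal x n} = (\<Inter>n\<in>N. {x. x \<bullet> n = 0})" by (auto simp: orthogonal_def)
    then show ?thesis
      by (simp only:) (intro closed_INT ballI closed_Collect_eq continuous_intros)
  qed
  then have "compact S" unfolding S_def by (intro compact_Int_closed) auto
  have cont: "continuous_on S (\<lambda>x. x \<bullet> g x)"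
    using g by (intro continuous_intros linear_continuous_on) (simp add: linear_conv_bounded_linear)
  have "\<exists>c>0. \<forall>x\<in>S. c \<le> x \<bullet> g x"
  proof (cases "S = {}")
    case False
    then obtain x where x: "x \<in> S" "\<And>y. y \<in> S \<Longrightarrow> x \<bullet> g x \<le> y \<bullet> g y"
      using continuous_attains_inf[OF \<open>compact S\<close> False cont] by blast
    have "x \<bullet> g x \<noteq> 0"
    proof
      assume "x \<bullet> g x = 0"
      then have "x \<in> N" by (simp add: N_def)
      then have "orthogonal x x" using x(1) unfolding S_def by blast
      then show False using x(1) by (auto simp: S_def orthogonal_def)
    qed
    then show ?thesis using nonneg[of x] x(2) by (intro exI[of _ "x \<bullet> g x"]) auto
  \<comment> \<open>If \<open>N\<close> is the whole space, then \<open>S\<close> is empty and any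
    positive constant serves.\<close>
  qed (auto intro: exI[of _ 1])
  then obtain c where c: "c > 0" "\<And>x. x \<in> S \<Longrightarrow> c \<le> x \<bullet> g x" by blast
  obtain B where B: "B > 0" "\<And>x. norm (h x) \<le> B * norm x"
    using linear_bounded_pos[OF h] by blast
  show ?thesis
  \<comment> \<open>For the component \<open>b\<close> of \<open>x\<close> orthogonal to
    \<open>N\<close>, \<open>norm (h b)\<close> is at most \<open>B * norm b\<close>, and the form
    is at least \<open>c\<close> times the square of \<open>norm b\<close>.\<close>
  proof (intro exI[of _ "B\<^sup>2 / c"] conjI allI)
    show "0 \<le> B\<^sup>2 / c" using c by simp
    fix x
    obtain n b where nb: "n \<in> span N" "\<And>w. w \<in> span N \<Longrightarrow> orthogonal b w" "x = n + b"
      using orthogonal_subspace_decomp_exists[of N x] by blast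
    then have n: "n \<in> N" and b: "\<And>w. w \<in> N \<Longrightarrow> orthogonal b w"
      using N by (simp_all add: span_eq_iff[THEN iffD2])
    have cb: "c * (norm b)\<^sup>2 \<le> b \<bullet> g b"
    proof (cases "b = 0")
      case False
      define u where "u = b /\<^sub>R norm b"
      have "u \<in> S" using False b by (auto simp: S_def u_def orthogonal_def)
      from c(2)[OF this] have "c \<le> (b \<bullet> g b) / (norm b)\<^sup>2"
        by (simp add: u_def g.scale power2_eq_square divide_simps)
      then show ?thesis using False by (simp add: field_simps)
    qed simp
    have "h x = h b" using n null[of n] by (simp add: nb(3) N_def h.add)
    then have "(norm (h x))\<^sup>2 \<le> (B * norm b)\<^sup>2" using B(2)[of b] by (simp add: power_mono)
    also have "\<dots> = B\<^sup>2 / c * (c * (norm b)\<^sup>2)" using c by (simp add: power_mult_distrib)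
    also have "\<dots> \<le> B\<^sup>2 / c * (b \<bullet> g b)" using cb c by (intro mult_left_mono) auto
    also have "b \<bullet> g b = x \<bullet> g x" using q_add[OF n, of b] nb(3) by simp
    finally show "(norm (h x))\<^sup>2 \<le> B\<^sup>2 / c * (x \<bullet> g x)" .
  qed
qed

text \<open>The lower bound is \<open>psd_form_dominates\<close> with the identity as
  \<open>h\<close>; the upper one is Cauchy-Schwarz with an operator bound.\<close>

lemma positive_definite_bounds:
  assumes "positive_definite P"
  shows "\<exists>c>0. \<exists>C>0. \<forall>x. c * (norm x)\<^sup>2 \<le> x \<bullet> (P *v x) \<and> x \<bullet> (P *v x) \<le> C * (norm x)\<^sup>2"
proof -
  have pos: "x \<noteq> 0 \<Longrightarrow> 0 < x \<bullet> (P *v x)" for x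
    using assms by (simp add: positive_definite_def)
  then have nonneg: "0 \<le> x \<bullet> (P *v x)" for x by (cases "x = 0") (auto intro: less_imp_le)
  have "\<exists>K\<ge>0. \<forall>x. (norm x)\<^sup>2 \<le> K * (x \<bullet> (P *v x))"
    using psd_form_dominates[OF matrix_vector_mul_linear linear_ident nonneg] pos by fastforce
  then obtain K where K: "K \<ge> 0" "\<And>x. (norm x)\<^sup>2 \<le> K * (x \<bullet> (P *v x))" by blast
  obtain B where B: "B > 0" "\<And>x. norm (P *v x) \<le> B * norm x"
    using linear_bounded_pos[OF matrix_vector_mul_linear[of P]] by blast
  \<comment> \<open>\<open>K\<close> may be 0, so \<open>K + 1\<close> is inverted instead.\<close>
  have "1 / (K + 1) * (norm x)\<^sup>2 \<le> x \<bullet> (P *v x)" for x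
  proof -
    have "(norm x)\<^sup>2 \<le> (K + 1) * (x \<bullet> (P *v x))"
      using K(2)[of x] nonneg[of x] by (simp add: distrib_right)
    then show ?thesis using K(1) by (simp add: field_simps)
  qed
  moreover have "x \<bullet> (P *v x) \<le> B * (norm x)\<^sup>2" for x
  proof -
    have "x \<bullet> (P *v x) \<le> norm x * norm (P *v x)" by (rule norm_cauchy_schwarz)
    also have "\<dots> \<le> norm x * (B * norm x)" using B(2) by (rule mult_left_mono) simp
    finally show ?thesis by (simp add: power2_eq_square algebra_simps)
  qed
  ultimately show ?thesis using K(1) B(1)
    by (intro exI[of _ "1 / (K + 1)"] conjI exI[of _ B]) auto
qed

section \<open>Linear differential equations\<close>

text \<open>Classical solutions: the equation holds at every point of \<open>S\<close>, with
  one-sided derivatives at the endpoints of an interval.\<close>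

definition linear_ode_on :: "real set \<Rightarrow> real^'n^'n \<Rightarrow> (real \<Rightarrow> real^'n) \<Rightarrow> bool" where
  "linear_ode_on S A y \<longleftrightarrow> (\<forall>t\<in>S. (y has_vector_derivative A *v y t) (at t within S))"

lemma has_vector_derivative_matrix_vector_mult:
  fixes A :: "real^'n^'m"
  assumes "(y has_vector_derivative y') F"
  shows "((\<lambda>t. A *v y t) has_vector_derivative A *v y') F"
  using bounded_linear.has_vector_derivative[OF matrix_vector_mul_bounded_linear assms] .

lemma has_vector_derivative_mat_power_ode:
  assumes "linear_ode_on S A y" "t \<in> S"
  shows "((\<lambda>t. mat_power A k *v y t) has_vector_derivative mat_power A (Suc k) *v y t) (at t within S)"
proof (induction k)
  case 0
  then show ?case using assms by (simp add: linear_ode_on_def)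
next
  case (Suc k)
  from has_vector_derivative_matrix_vector_mult[OF this, of A] show ?case
    by (simp add: matrix_vector_mul_assoc)
qed

text \<open>The velocity of a solution is again a solution, so growth bounds apply to it as
  well.\<close>

lemma linear_ode_on_mult: "linear_ode_on S A y \<Longrightarrow> linear_ode_on S A (\<lambda>t. A *v y t)"
  unfolding linear_ode_on_def by (intro ballI has_vector_derivative_matrix_vector_mult) auto

lemma linear_ode_on_diff:
  "linear_ode_on S A y \<Longrightarrow> linear_ode_on S A z \<Longrightarrow> linear_ode_on S A (\<lambda>t. y t - z t)"
  unfolding linear_ode_on_def
  by (auto simp: matrix_vector_mult_diff_distrib intro!: has_vector_derivative_diff)

lemma linear_ode_on_subset: "linear_ode_on S A y \<Longrightarrow> T \<subseteq> S \<Longrightarrow> linear_ode_on T A y"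
  unfolding linear_ode_on_def by (meson has_vector_derivative_within_subset subsetD)

lemma linear_ode_on_shift:
  assumes "linear_ode_on {a..b} A y"
  shows "linear_ode_on {a + c..b + c} A (\<lambda>t. y (t - c))"
  unfolding linear_ode_on_def
proof
  fix t assume t: "t \<in> {a + c..b + c}"
  have "((\<lambda>t. t - c) has_vector_derivative 1) (at t within {a + c..b + c})"
    by (auto intro!: derivative_eq_intros)
  moreover have "(\<lambda>t. t - c) ` {a + c..b + c} = {a..b}" by simp
  moreover have "(y has_vector_derivative A *v y (t - c)) (at (t - c) within {a..b})"
    using assms t by (auto simp: linear_ode_on_def)
  ultimately show "((\<lambda>t. y (t - c)) has_vector_derivative A *v y (t - c)) (at t within {a + c..b + c})"
    using vector_diff_chain_within[of "\<lambda>t. t - c" 1 t "{a + c..b + c}" y "A *v y (t - c)"]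
    by (simp add: o_def)
qed

section \<open>Exponential growth bound and uniqueness of solutions\<close>

lemma deriv_nonpos_imp_le:
  fixes \<phi> :: "real \<Rightarrow> real"
  assumes "a \<le> b"
    and "\<And>t. t \<in> {a..b} \<Longrightarrow> (\<phi> has_vector_derivative \<phi>' t) (at t within {a..b})"
    and "\<And>t. t \<in> {a..b} \<Longrightarrow> \<phi>' t \<le> 0"
  shows "\<phi> b \<le> \<phi> a"
proof -
  have "\<exists>t\<in>{a..b}. \<phi> b - \<phi> a = (b - a) * \<phi>' t"
    using mvt_very_simple[OF assms(1), of \<phi> "\<lambda>t s. s * \<phi>' t"] assms(2)
    by (auto simp: has_vector_derivative_def)
  then obtain t where "t \<in> {a..b}" "\<phi> b - \<phi> a = (b - a) * \<phi>' t" by blast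
  moreover from this have "(b - a) * \<phi>' t \<le> 0"
    using assms by (intro mult_nonneg_nonpos) auto
  ultimately show ?thesis by linarith
qed

text \<open>A Gronwall estimate: the square of the norm, weighted by
  \<open>exp (- 2 * L * (t - a))\<close>, has nonpositive derivative by Cauchy-Schwarz.\<close>

lemma linear_ode_growth:
  assumes y: "linear_ode_on {a..b} A y" and "a \<le> b"
    and L: "\<And>x. norm (A *v x) \<le> L * norm x"
  shows "norm (y b) \<le> exp (L * (b - a)) * norm (y a)"
proof -
  define \<phi> where "\<phi> t = exp (- 2 * L * (t - a)) * (y t \<bullet> y t)" for t
  have "\<phi> b \<le> \<phi> a"
  proof (rule deriv_nonpos_imp_le[OF \<open>a \<le> b\<close>])
    fix t assume t: "t \<in> {a..b}"
    have y': "(y has_vector_derivative A *v y t) (at t within {a..b})"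
      using y t by (simp add: linear_ode_on_def)
    have yy: "((\<lambda>t. y t \<bullet> y t) has_vector_derivative y t \<bullet> (A *v y t) + (A *v y t) \<bullet> y t) (at t within {a..b})"
      by (rule bounded_bilinear.has_vector_derivative[OF bounded_bilinear_inner y' y'])
    have ee: "((\<lambda>t. exp (- 2 * L * (t - a))) has_vector_derivative exp (- 2 * L * (t - a)) * (- 2 * L)) (at t within {a..b})"
      unfolding has_real_derivative_iff_has_vector_derivative[symmetric]
      by (auto intro!: derivative_eq_intros)
    show "(\<phi> has_vector_derivative
        exp (- 2 * L * (t - a)) * (2 * (y t \<bullet> (A *v y t)) - 2 * L * (y t \<bullet> y t))) (at t within {a..b})"
      unfolding \<phi>_def
      using bounded_bilinear.has_vector_derivative[OF bounded_bilinear_mult ee yy]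
      by (simp add: algebra_simps inner_commute)
    have "y t \<bullet> (A *v y t) \<le> norm (y t) * norm (A *v y t)" by (rule norm_cauchy_schwarz)
    also have "\<dots> \<le> norm (y t) * (L * norm (y t))" using L by (intro mult_left_mono) auto
    also have "\<dots> = L * (y t \<bullet> y t)" by (simp add: power2_norm_eq_inner[symmetric] power2_eq_square)
    finally show "exp (- 2 * L * (t - a)) * (2 * (y t \<bullet> (A *v y t)) - 2 * L * (y t \<bullet> y t)) \<le> 0"
      by (intro mult_nonneg_nonpos) auto
  qed
  then have "exp (- 2 * L * (b - a)) * (norm (y b))\<^sup>2 \<le> (norm (y a))\<^sup>2"
    by (simp add: \<phi>_def power2_norm_eq_inner)
  then have "exp (2 * L * (b - a)) * (exp (- 2 * L * (b - a)) * (norm (y b))\<^sup>2)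
      \<le> exp (2 * L * (b - a)) * (norm (y a))\<^sup>2"
    by (intro mult_left_mono) auto
  also have "exp (2 * L * (b - a)) * (exp (- 2 * L * (b - a)) * (norm (y b))\<^sup>2) = (norm (y b))\<^sup>2"
    by (simp add: mult.assoc[symmetric] exp_add[symmetric])
  also have "exp (2 * L * (b - a)) * (norm (y a))\<^sup>2 = (exp (L * (b - a)) * norm (y a))\<^sup>2"
    by (simp add: power_mult_distrib exp_double[symmetric] mult.assoc)
  finally show ?thesis by (rule power2_le_imp_le) simp
qed

text \<open>The growth bound is applied to the difference, which starts at 0.\<close>

lemma linear_ode_unique:
  assumes "linear_ode_on {a..b} A y" "linear_ode_on {a..b} A z" "y a = z a" "t \<in> {a..b}"
  shows "y t = z t"
proof -
  obtain L where "L > 0" and L: "\<And>x. norm (A *v x) \<le> L * norm x"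
    using linear_bounded_pos[OF matrix_vector_mul_linear[of A]] by blast
  have "linear_ode_on {a..t} A (\<lambda>s. y s - z s)"
    using assms by (intro linear_ode_on_diff) (auto intro: linear_ode_on_subset)
  from linear_ode_growth[OF this _ L] assms show ?thesis by simp
qed

text \<open>The library's \<open>exp\<close> does not apply to matrices, so \<open>exp (t A) \<xi>\<close> is written as a power series in
  each component.\<close>

definition flow :: "real^'n^'n \<Rightarrow> real \<Rightarrow> real^'n \<Rightarrow> real^'n" where
  "flow A t \<xi> = (\<chi> i. \<Sum>k. (mat_power A k *v \<xi>) $ i / fact k * t ^ k)"

section \<open>The flow: convergence, linearity and differential equation\<close>

lemma norm_mat_power_le:
  assumes "\<And>x. norm (A *v x) \<le> L * norm x" "0 \<le> L"
  shows "norm (mat_power A k *v \<xi>) \<le> L ^ k * norm \<xi>"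
proof (induction k)
  case (Suc k)
  have "norm (mat_power A (Suc k) *v \<xi>) \<le> L * norm (mat_power A k *v \<xi>)"
    using assms(1)[of "mat_power A k *v \<xi>"] by (simp add: matrix_vector_mul_assoc)
  also have "\<dots> \<le> L * (L ^ k * norm \<xi>)" using Suc assms(2) by (rule mult_left_mono)
  finally show ?case by simp
qed simp

lemma summable_flow: "summable (\<lambda>k. (mat_power A k *v \<xi>) $ i / fact k * t ^ k)"
proof -
  obtain L where L: "L > 0" "\<And>x. norm (A *v x) \<le> L * norm x"
    using linear_bounded_pos[OF matrix_vector_mul_linear[of A]] by blast
  show ?thesis
  proof (rule summable_comparison_test')
    show "summable (\<lambda>k. norm \<xi> * (inverse (fact k) * (L * \<bar>t\<bar>) ^ k))"
      by (intro summable_mult summable_exp)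
    fix k
    have "\<bar>(mat_power A k *v \<xi>) $ i\<bar> \<le> L ^ k * norm \<xi>"
      using norm_mat_power_le[OF L(2)] L(1) component_le_norm_cart order.trans by (metis less_imp_le)
    then have "\<bar>(mat_power A k *v \<xi>) $ i\<bar> * (\<bar>t\<bar> ^ k / fact k) \<le> L ^ k * norm \<xi> * (\<bar>t\<bar> ^ k / fact k)"
      by (rule mult_right_mono) simp
    then show "norm ((mat_power A k *v \<xi>) $ i / fact k * t ^ k) \<le> norm \<xi> * (inverse (fact k) * (L * \<bar>t\<bar>) ^ k)"
      by (simp add: abs_mult power_abs power_mult_distrib field_simps)
  qed
qed

lemma mat_power_mult_commute: "mat_power A k ** A = A ** mat_power A k"
  by (induction k) (auto simp: matrix_mul_assoc[symmetric])

lemma linear_flow: "linear (flow A t)"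
proof (rule linearI)
  show "flow A t (\<xi> + \<eta>) = flow A t \<xi> + flow A t \<eta>" for \<xi> \<eta>
    unfolding vec_eq_iff flow_def vector_add_component vec_lambda_beta
      suminf_add[OF summable_flow summable_flow] matrix_vector_right_distrib
    by (simp add: add_divide_distrib distrib_right)
  show "flow A t (c *\<^sub>R \<xi>) = c *\<^sub>R flow A t \<xi>" for c \<xi>
    unfolding vec_eq_iff flow_def vector_scaleR_component vec_lambda_beta real_scaleR_def
      suminf_mult[OF summable_flow, symmetric] matrix_vector_mult_scaleR
    by (simp add: mult.assoc)
qed

lemma flow_0 [simp]: "flow A 0 \<xi> = \<xi>"
proof -
  have "(\<Sum>k. (mat_power A k *v \<xi>) $ i / fact k * 0 ^ k) = \<xi> $ i" for i
    using powser_zero[of "\<lambda>k. (mat_power A k *v \<xi>) $ i / fact k"] by simp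
  then show ?thesis by (simp add: flow_def vec_eq_iff)
qed

text \<open>\<open>A\<close> commutes with its powers, and multiplication by \<open>A\<close> is a
  finite sum in each component, which may be exchanged with the convergent series.\<close>

lemma flow_mult: "flow A t (A *v \<xi>) = A *v flow A t \<xi>"
proof -
  have "flow A t (A *v \<xi>) $ i = (A *v flow A t \<xi>) $ i" for i
  proof -
    have "(mat_power A k *v (A *v \<xi>)) $ i / fact k * t ^ k
        = (\<Sum>j\<in>UNIV. A $ i $ j * ((mat_power A k *v \<xi>) $ j / fact k * t ^ k))" for k
      unfolding matrix_vector_mul_assoc mat_power_mult_commute
      unfolding matrix_vector_mul_assoc[symmetric]
      by (simp add: matrix_vector_mult_def[of A] sum_distrib_right sum_divide_distrib mult.assoc)
    then have "flow A t (A *v \<xi>) $ i = (\<Sum>k. \<Sum>j\<in>UNIV. A $ i $ j * ((mat_power A k *v \<xi>) $ j / fact k * t ^ k))"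
      by (simp add: flow_def)
    also have "\<dots> = (\<Sum>j\<in>UNIV. \<Sum>k. A $ i $ j * ((mat_power A k *v \<xi>) $ j / fact k * t ^ k))"
      by (intro suminf_sum summable_mult summable_flow)
    also have "\<dots> = (\<Sum>j\<in>UNIV. A $ i $ j * flow A t \<xi> $ j)"
      by (simp only: flow_def vec_lambda_beta suminf_mult[OF summable_flow])
    finally show ?thesis by (simp add: matrix_vector_mult_def)
  qed
  then show ?thesis by (simp add: vec_eq_iff)
qed

lemma linear_ode_on_flow: "linear_ode_on S A (\<lambda>t. flow A t \<xi>)"
  unfolding linear_ode_on_def
proof
  fix t
  have "((\<lambda>t. flow A t \<xi> $ i) has_field_derivative flow A t (A *v \<xi>) $ i) (at t)" for i
  proof -
    \<comment> \<open>Termwise differentiation shifts the coefficients by one, which amounts to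
      replacing \<xi> by \<open>A *v \<xi>\<close>.\<close>
    have "diffs (\<lambda>k. (mat_power A k *v \<xi>) $ i / fact k) = (\<lambda>k. (mat_power A k *v (A *v \<xi>)) $ i / fact k)"
      unfolding diffs_def
      by (rule ext) (simp add: matrix_vector_mul_assoc mat_power_mult_commute field_simps del: of_nat_Suc)
    then show ?thesis
      using termdiffs_strong_converges_everywhere[OF summable_flow, of A \<xi> i t] by (simp add: flow_def)
  qed
  then have "((\<lambda>t. flow A t \<xi>) has_vector_derivative flow A t (A *v \<xi>)) (at t)"
    unfolding has_vector_derivative_def has_derivative_componentwise_within[where f = "\<lambda>t. flow A t \<xi>"]
    by (auto simp: Basis_vec_def inner_axis has_field_derivative_def mult_commute_abs)
  then show "((\<lambda>t. flow A t \<xi>) has_vector_derivative A *v flow A t \<xi>) (at t within S)"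
    by (simp add: flow_mult has_vector_derivative_at_within)
qed

text \<open>With a constant matrix the right-hand side is continuous in time. Near \<open>t\<close>
  the velocity, where it exists, is thus within \<open>e\<close> of \<open>A *v y t\<close>, and
  \<open>abs_cont_on_deriv_bound\<close> with this vector as \<open>c\<close> gives
  differentiability at every \<open>t\<close>, also in \<open>N\<close>.\<close>

lemma abs_cont_ode_imp_classical:
  fixes y :: "real \<Rightarrow> real^'n"
  assumes ac: "abs_cont_on {a..b} y" and N: "negligible N"
    and y': "\<And>t. \<lbrakk>t \<in> {a..b}; t \<notin> N\<rbrakk> \<Longrightarrow> (y has_vector_derivative A *v y t) (at t within {a..b})"
  shows "linear_ode_on {a..b} A y"
  unfolding linear_ode_on_def has_vector_derivative_def has_derivative_within_alt
proof (intro ballI conjI allI impI)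
  fix t e :: real assume t: "t \<in> {a..b}" and "e > 0"
  have "continuous_on {a..b} (\<lambda>t. A *v y t)"
    using abs_cont_on_imp_continuous[OF ac]
    by (rule bounded_linear.continuous_on[OF matrix_vector_mul_bounded_linear])
  then obtain d where d: "d > 0" "\<And>s. s \<in> {a..b} \<Longrightarrow> dist s t < d \<Longrightarrow> dist (A *v y s) (A *v y t) < e"
    using t \<open>e > 0\<close> unfolding continuous_on_iff by blast
  have bound: "norm (y v - y u - (v - u) *\<^sub>R (A *v y t)) \<le> e * (v - u)"
    if "u \<le> v" "{u..v} \<subseteq> {a..b}" "\<And>s. s \<in> {u..v} \<Longrightarrow> dist s t < d" for u v
  proof (rule abs_cont_on_deriv_bound[OF abs_cont_on_subset[OF ac that(2)] that(1) N])
    show "(y has_vector_derivative A *v y s) (at s within {u..v})" if "s \<in> {u..v}" "s \<notin> N" for s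
      using y'[of s] that \<open>{u..v} \<subseteq> {a..b}\<close> has_vector_derivative_within_subset by blast
    show "norm (A *v y s - A *v y t) \<le> e" if "s \<in> {u..v}" "s \<notin> N" for s
      using d(2)[of s] that \<open>{u..v} \<subseteq> {a..b}\<close> \<open>\<And>s. s \<in> {u..v} \<Longrightarrow> dist s t < d\<close>
      by (auto simp: dist_norm less_imp_le)
  qed (use \<open>e > 0\<close> in simp)
  show "\<exists>d>0. \<forall>s\<in>{a..b}. norm (s - t) < d \<longrightarrow>
      norm (y s - y t - (s - t) *\<^sub>R (A *v y t)) \<le> e * norm (s - t)"
  proof (intro exI[of _ d] conjI ballI impI)
    fix s assume s: "s \<in> {a..b}" "norm (s - t) < d"
    show "norm (y s - y t - (s - t) *\<^sub>R (A *v y t)) \<le> e * norm (s - t)"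
    proof (cases "t \<le> s")
      case True
      then show ?thesis using bound[of t s] s t by (auto simp: dist_real_def)
    next
      case False
      then have "norm (y t - y s - (t - s) *\<^sub>R (A *v y t)) \<le> e * (t - s)"
        using bound[of s t] s t by (auto simp: dist_real_def)
      also have "norm (y t - y s - (t - s) *\<^sub>R (A *v y t)) = norm (y s - y t - (s - t) *\<^sub>R (A *v y t))"
        by (subst norm_minus_cancel[symmetric]) (simp add: algebra_simps)
      finally show ?thesis using False by simp
    qed
  qed (rule d(1))
qed (rule bounded_linear_scaleR_left)

section \<open>Observability and the Lyapunov drop\<close>

lemma inner_gram: "\<xi> \<bullet> (gram C *v \<xi>) = (\<Sum>r\<leftarrow>C. (r \<bullet> \<xi>)\<^sup>2)"
proof (induction C)
  case Nil
  have "gram [] *v \<xi> = 0" by (simp add: gram_def matrix_vector_mult_def vec_eq_iff)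
  then show ?case by simp
next
  case (Cons r C)
  have "gram (r # C) *v \<xi> = (r \<bullet> \<xi>) *\<^sub>R r + gram C *v \<xi>"
    by (simp add: gram_def matrix_vector_mult_def vec_eq_iff inner_vec_def sum.distrib
        sum_distrib_left algebra_simps)
  then show ?case using Cons by (simp add: inner_add_right power2_eq_square inner_commute)
qed

text \<open>The left-hand side is the derivative of \<open>y \<bullet> (P *v y)\<close> along a
  solution \<open>y\<close> at a time when it passes through \<xi>.\<close>

lemma lyapunov_inner_le:
  assumes "P ** A + transpose A ** P \<preceq> - gram C"
  shows "\<xi> \<bullet> (P *v (A *v \<xi>)) + (A *v \<xi>) \<bullet> (P *v \<xi>) \<le> - (\<Sum>r\<leftarrow>C. (r \<bullet> \<xi>)\<^sup>2)"
proof -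
  have "0 \<le> \<xi> \<bullet> ((- gram C - (P ** A + transpose A ** P)) *v \<xi>)"
    using assms by (simp add: semidefinite_le_def positive_semidefinite_def)
  also have "(- gram C - (P ** A + transpose A ** P)) *v \<xi>
      = - (gram C *v \<xi>) - (P *v (A *v \<xi>) + transpose A *v (P *v \<xi>))"
    by (simp add: matrix_vector_mul_assoc matrix_vector_mult_diff_rdistrib matrix_vector_mult_add_rdistrib
        del: transpose_matrix_vector) (simp add: matrix_vector_mult_def vec_eq_iff sum_negf)
  also have "\<xi> \<bullet> \<dots> = - (\<xi> \<bullet> (gram C *v \<xi>)) - (\<xi> \<bullet> (P *v (A *v \<xi>)) + (A *v \<xi>) \<bullet> (P *v \<xi>))"
    using dot_lmul_matrix[of "P *v \<xi>" A \<xi>] by (simp add: inner_diff_right inner_add_right inner_commute)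
  finally show ?thesis by (simp add: inner_gram)
qed

lemma has_vector_derivative_quadratic_form:
  assumes "linear_ode_on S A y" "t \<in> S"
  shows "((\<lambda>t. y t \<bullet> (P *v y t)) has_vector_derivative
      y t \<bullet> (P *v (A *v y t)) + (A *v y t) \<bullet> (P *v y t)) (at t within S)"
  using assms unfolding linear_ode_on_def
  by (intro bounded_bilinear.has_vector_derivative[OF bounded_bilinear_inner]
      has_vector_derivative_matrix_vector_mult) auto

lemma lyapunov_decreasing:
  assumes "P ** A + transpose A ** P \<preceq> - gram C" "linear_ode_on {a..b} A y"
    "a \<le> s" "s \<le> t" "t \<le> b"
  shows "y t \<bullet> (P *v y t) \<le> y s \<bullet> (P *v y s)"
proof (rule deriv_nonpos_imp_le[OF \<open>s \<le> t\<close>])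
  fix u assume u: "u \<in> {s..t}"
  have "linear_ode_on {s..t} A y"
    using assms by (auto intro: linear_ode_on_subset)
  then show "((\<lambda>t. y t \<bullet> (P *v y t)) has_vector_derivative
      y u \<bullet> (P *v (A *v y u)) + (A *v y u) \<bullet> (P *v y u)) (at u within {s..t})"
    using u by (rule has_vector_derivative_quadratic_form)
  have "0 \<le> (\<Sum>r\<leftarrow>C. (r \<bullet> y u)\<^sup>2)" by (rule sum_list_nonneg) auto
  then show "y u \<bullet> (P *v (A *v y u)) + (A *v y u) \<bullet> (P *v y u) \<le> 0"
    using lyapunov_inner_le[OF assms(1), of "y u"] by linarith
qed

text \<open>Derivatives within a nondegenerate closed interval are unique, even at its endpoints.
  This allows an identity on \<open>{a..b}\<close> to be differentiated at \<open>a\<close>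
  too.\<close>

lemma deriv_of_constant_eq_0:
  assumes "a < b" "t \<in> {a..b}" "\<And>s. s \<in> {a..b} \<Longrightarrow> \<phi> s = c"
    and "(\<phi> has_vector_derivative d) (at t within {a..b})"
  shows "d = 0"
proof -
  have "(\<phi> has_vector_derivative 0) (at t within {a..b})"
    using has_vector_derivative_transform[OF assms(2) assms(3) has_vector_derivative_const] by simp
  then show ?thesis
    using vector_derivative_unique_within_closed_interval[of a b t \<phi> d 0] assms by simp
qed

text \<open>Equal values at both ends make the nonincreasing Lyapunov function constant. Its
  derivative then vanishes, which annihilates every output \<open>r \<bullet> y t\<close>;
  differentiating these identities repeatedly and evaluating at \<open>a\<close> gives
  unobservability.\<close>

lemma lyapunov_constant_imp_unobservable:
  assumes lyap: "P ** A + transpose A ** P \<preceq> - gram C" and y: "linear_ode_on {a..b} A y"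
    and "a < b" and eq: "y b \<bullet> (P *v y b) = y a \<bullet> (P *v y a)"
  shows "y a \<in> unobservable_subspace C A"
proof -
  have const: "y t \<bullet> (P *v y t) = y a \<bullet> (P *v y a)" if "t \<in> {a..b}" for t
    using lyapunov_decreasing[OF lyap y, of a t] lyapunov_decreasing[OF lyap y, of t b] eq that
    by force
  have "r \<bullet> y t = 0" if "r \<in> set C" "t \<in> {a..b}" for r t
  proof -
    have "y t \<bullet> (P *v (A *v y t)) + (A *v y t) \<bullet> (P *v y t) = 0"
      using deriv_of_constant_eq_0[OF \<open>a < b\<close> that(2) const has_vector_derivative_quadratic_form[OF y that(2)]]
      by blast
    then have "(\<Sum>r\<leftarrow>C. (r \<bullet> y t)\<^sup>2) \<le> 0"
      using lyapunov_inner_le[OF lyap, of "y t"] by linarith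
    moreover have "(r \<bullet> y t)\<^sup>2 \<le> (\<Sum>r\<leftarrow>C. (r \<bullet> y t)\<^sup>2)"
      using that(1) by (intro member_le_sum_list) auto
    ultimately have "(r \<bullet> y t)\<^sup>2 \<le> 0" by linarith
    then show ?thesis by simp
  qed
  then have "r \<bullet> (mat_power A k *v y t) = 0" if "r \<in> set C" "t \<in> {a..b}" for r t k
    using that
  \<comment> \<open>The induction runs over all times of the interval at once, since differentiating
    needs the previous identity on the whole interval.\<close>
  proof (induction k arbitrary: t)
    case (Suc k)
    have "((\<lambda>t. r \<bullet> (mat_power A k *v y t)) has_vector_derivative r \<bullet> (mat_power A (Suc k) *v y t)) (at t within {a..b})"
      by (intro bounded_linear.has_vector_derivative[OF bounded_linear_inner_right]
          has_vector_derivative_mat_power_ode y Suc.prems)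
    then show ?case
      using deriv_of_constant_eq_0[OF \<open>a < b\<close> Suc.prems(3), of "\<lambda>t. r \<bullet> (mat_power A k *v y t)" 0]
        Suc by blast
  qed simp
  then show ?thesis
    using \<open>a < b\<close> by (auto simp: unobservable_subspace_def rows_ker_def rows_mult_def dot_lmul_matrix)
qed

text \<open>The drop of the Lyapunov function over a time span \<open>h\<close> is a positive semidefinite quadratic
  form in the initial state which vanishes only on unobservable states.\<close>

lemma lyapunov_drop_bound:
  assumes lyap: "P ** A + transpose A ** P \<preceq> - gram C"
    and unobs: "unobservable_subspace C A \<subseteq> ker A" and "h > 0"
  shows "\<exists>K\<ge>0. \<forall>a y. linear_ode_on {a..a + h} A y \<longrightarrow> (\<forall>t\<in>{a..a + h}.
    (norm (A *v y t))\<^sup>2 \<le> K * (y a \<bullet> (P *v y a) - y (a + h) \<bullet> (P *v y (a + h))))"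
proof -
  define \<Phi> where "\<Phi> = flow A h"
  have lin: "linear \<Phi>" by (simp add: \<Phi>_def linear_flow)
  \<comment> \<open>The adjoint brings the drop from \<xi> to \<open>\<Phi> \<xi>\<close> into the
    form \<open>\<xi> \<bullet> g \<xi>\<close>.\<close>
  define g where "g \<xi> = P *v \<xi> - adjoint \<Phi> (P *v \<Phi> \<xi>)" for \<xi>
  have g: "linear g"
    unfolding g_def
    using linear_compose[OF lin linear_compose[OF matrix_vector_mul_linear[of P] adjoint_linear[OF lin]]]
    by (intro linear_compose_sub) (simp_all add: o_def)
  have drop: "\<xi> \<bullet> g \<xi> = \<xi> \<bullet> (P *v \<xi>) - \<Phi> \<xi> \<bullet> (P *v \<Phi> \<xi>)" for \<xi>
    by (simp add: g_def inner_diff_right adjoint_works[OF lin])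
  have ode: "linear_ode_on {0..h} A (\<lambda>t. flow A t \<xi>)" for \<xi> by (rule linear_ode_on_flow)
  have "\<exists>K\<ge>0. \<forall>\<xi>. (norm (A *v \<xi>))\<^sup>2 \<le> K * (\<xi> \<bullet> g \<xi>)"
  proof (rule psd_form_dominates[OF g matrix_vector_mul_linear])
    show "0 \<le> \<xi> \<bullet> g \<xi>" for \<xi>
      using lyapunov_decreasing[OF lyap ode, of 0 h] \<open>h > 0\<close> by (simp add: drop \<Phi>_def)
    show "A *v \<xi> = 0" if "\<xi> \<bullet> g \<xi> = 0" for \<xi>
      using lyapunov_constant_imp_unobservable[OF lyap ode \<open>h > 0\<close>, of \<xi>] that unobs
      by (auto simp: drop \<Phi>_def ker_def)
  qed
  then obtain K where K: "K \<ge> 0" "\<And>\<xi>. (norm (A *v \<xi>))\<^sup>2 \<le> K * (\<xi> \<bullet> g \<xi>)" by blast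
  obtain L where L: "L > 0" "\<And>x. norm (A *v x) \<le> L * norm x"
    using linear_bounded_pos[OF matrix_vector_mul_linear[of A]] by blast
  show ?thesis
  \<comment> \<open>\<open>K\<close> bounds the velocity at the initial time \<open>a\<close> only;
    the exponential factor carries the bound to later times of the interval.\<close>
  proof (intro exI[of _ "(exp (L * h))\<^sup>2 * K"] conjI allI impI ballI)
    show "0 \<le> (exp (L * h))\<^sup>2 * K" using K by simp
    fix a y t assume y: "linear_ode_on {a..a + h} A y" and t: "t \<in> {a..a + h}"
    \<comment> \<open>Uniqueness identifies \<open>y\<close> with the shifted flow, so
      \<open>y (a + h)\<close> is a linear function of \<open>y a\<close> that does not depend on
      \<open>a\<close>.\<close>
    have "linear_ode_on {a..a + h} A (\<lambda>t. flow A (t - a) (y a))"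
      using linear_ode_on_shift[OF ode, of a "y a"] by (simp add: add.commute)
    from linear_ode_unique[OF y this, of "a + h"] have \<Phi>: "y (a + h) = \<Phi> (y a)"
      using \<open>h > 0\<close> by (simp add: \<Phi>_def)
    have "linear_ode_on {a..t} A (\<lambda>t. A *v y t)"
      using y t by (intro linear_ode_on_mult linear_ode_on_subset[OF y]) auto
    from linear_ode_growth[OF this _ L(2)]
    have "norm (A *v y t) \<le> exp (L * (t - a)) * norm (A *v y a)" using t by simp
    also have "\<dots> \<le> exp (L * h) * norm (A *v y a)" using t L(1) by (intro mult_right_mono) auto
    finally have "(norm (A *v y t))\<^sup>2 \<le> (exp (L * h))\<^sup>2 * (norm (A *v y a))\<^sup>2"
      by (metis norm_ge_zero power_mono power_mult_distrib)
    also have "\<dots> \<le> (exp (L * h))\<^sup>2 * (K * (y a \<bullet> g (y a)))"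
      by (intro mult_left_mono K(2)) simp
    finally show "(norm (A *v y t))\<^sup>2 \<le> (exp (L * h))\<^sup>2 * K * (y a \<bullet> (P *v y a) - y (a + h) \<bullet> (P *v y (a + h)))"
      by (simp add: drop \<Phi> mult.assoc)
  qed
qed

section \<open>Switched trajectories\<close>

text \<open>A locally constant function on a connected set is constant. Since limits are taken
  within \<open>S\<close>, continuity from the right suffices at the left endpoint of an
  interval.\<close>

lemma constant_on_if_no_jump_times:
  assumes "connected S" "\<And>t. t \<in> S \<Longrightarrow> \<forall>\<^sub>F s in at t within S. \<sigma> s = \<sigma> t"
    and "s \<in> S" "t \<in> S"
  shows "\<sigma> s = \<sigma> t"
proof -
  have "\<sigma> constant_on S"
  proof (rule locally_constant_imp_constant[OF assms(1)])
    fix a assume "a \<in> S"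
    then obtain U where U: "open U" "a \<in> U" "\<And>s. s \<in> U \<Longrightarrow> s \<noteq> a \<Longrightarrow> s \<in> S \<Longrightarrow> \<sigma> s = \<sigma> a"
      using assms(2)[of a] unfolding eventually_at_topological by blast
    then show "\<exists>T. openin (top_of_set S) T \<and> a \<in> T \<and> (\<forall>s\<in>T. \<sigma> s = \<sigma> a)"
      using \<open>a \<in> S\<close> by (intro exI[of _ "S \<inter> U"]) (auto simp: openin_open)
  qed
  then show ?thesis using assms(3,4) by (auto simp: constant_on_def)
qed

text \<open>If a jump follows \<open>t\<close> within time \<open>h\<close>, then no jump precedes \<open>t\<close> within time \<open>h\<close>.\<close>

lemma dwell_time_constant_interval:
  assumes \<sigma>: "\<sigma> \<in> dwell_time_signals \<Gamma> \<tau>" and h: "0 < h" "3 * h \<le> \<tau>"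
  shows "\<exists>a. a \<le> t \<and> t \<le> a + h \<and> (\<forall>s\<in>{a..a + h}. \<sigma> s = \<sigma> t)"
proof (cases "\<exists>s\<in>{t<..t + h}. s \<in> jump_times \<sigma>")
  \<comment> \<open>The interval starts at \<open>t\<close>, which may itself be a jump time;
    continuity from the right covers this case.\<close>
  case False
  have "\<sigma> s = \<sigma> t" if "s \<in> {t..t + h}" for s
  proof (rule constant_on_if_no_jump_times[where S = "{t..t + h}" and \<sigma> = \<sigma>])
    fix u assume u: "u \<in> {t..t + h}"
    show "\<forall>\<^sub>F s in at u within {t..t + h}. \<sigma> s = \<sigma> u"
    proof (cases "u = t")
      case True
      have "\<forall>\<^sub>F s in at_right t. \<sigma> s = \<sigma> t"
        using \<sigma> by (simp add: dwell_time_signals_def switching_signals_def)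
      then show ?thesis using True h by (simp add: at_within_Icc_at_right)
    next
      case neq: False
      then have "u \<notin> jump_times \<sigma>" using u False by auto
      then have "\<forall>\<^sub>F s in at u. \<sigma> s = \<sigma> u" by (simp add: jump_times_def)
      then show ?thesis 
        by (auto simp: eventually_at_filter elim: eventually_mono)
    qed
  qed (use that h in auto)
  then show ?thesis using h by (intro exI[of _ t] conjI ballI) (simp, simp, blast)
next
  case True
  then obtain s0 where s0: "t < s0" "s0 \<le> t + h" "s0 \<in> jump_times \<sigma>" by auto
  \<comment> \<open>Every point of \<open>{t - h..t}\<close> has distance at most
    \<open>2 * h\<close> from the jump \<open>s0\<close>, less than the dwell time, so none is a
    jump time.\<close>
  have "\<sigma> s = \<sigma> t" if "s \<in> {t - h..t}" for s
  proof (rule constant_on_if_no_jump_times[where S = "{t - h..t}" and \<sigma> = \<sigma>])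
    fix u assume u: "u \<in> {t - h..t}"
    have "u \<notin> jump_times \<sigma>"
    proof
      assume "u \<in> jump_times \<sigma>"
      moreover have "u \<noteq> s0" using s0 u by simp
      ultimately have "\<tau> \<le> \<bar>u - s0\<bar>"
        using \<sigma> s0(3) by (simp add: dwell_time_signals_def)
      then show False using u s0 h by simp
    qed
    then have "\<forall>\<^sub>F s in at u. \<sigma> s = \<sigma> u" by (simp add: jump_times_def)
    then show "\<forall>\<^sub>F s in at u within {t - h..t}. \<sigma> s = \<sigma> u" 
        by (auto simp: eventually_at_filter elim: eventually_mono)
  qed (use that h in auto)
  then show ?thesis using h by (intro exI[of _ "t - h"] conjI ballI) (simp, simp, simp only: diff_add_cancel)
qed

lemma class_K_inf_linear: "c > 0 \<Longrightarrow> class_K_inf (\<lambda>r. c * r)"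
  unfolding class_K_inf_def
proof (intro conjI)
  assume c: "c > 0"
  show "strict_mono_on {0..} (\<lambda>r. c * r)" using c by (auto simp: strict_mono_on_def)
  show "continuous_on {0..} (\<lambda>r. c * r)" by (intro continuous_intros)
  show "\<not> bdd_above ((\<lambda>r. c * r) ` {0..})"
  proof
    assume "bdd_above ((\<lambda>r. c * r) ` {0..})"
    then obtain M where M: "\<And>r. r \<ge> 0 \<Longrightarrow> c * r \<le> M" by (auto simp: bdd_above_def)
    show False using M[of "(\<bar>M\<bar> + 1) / c"] c by auto
  qed
qed (auto simp: less_imp_le)

text \<open>From some time on, all values lie between the infimum and the infimum plus
  \<open>e\<close>.\<close>

lemma antimono_nonneg_drop:
  fixes v :: "real \<Rightarrow> real"
  assumes v: "antimono_on {0..} v" and nonneg: "\<And>t. 0 \<le> t \<Longrightarrow> 0 \<le> v t" and "0 \<le> h" "0 < e"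
  shows "\<exists>t1\<ge>0. \<forall>a\<ge>t1. v a - v (a + h) < e"
proof -
  have bdd: "bdd_below (v ` {0..})" using nonneg by (auto simp: bdd_below_def)
  have "\<exists>t1\<in>{0..}. v t1 < Inf (v ` {0..}) + e"
    using cInf_lessD[of "v ` {0..}" "Inf (v ` {0..}) + e"] \<open>0 < e\<close> by auto
  then obtain t1 where t1: "0 \<le> t1" "v t1 < Inf (v ` {0..}) + e" by auto
  have "v a - v (a + h) < e" if "t1 \<le> a" for a
  proof -
    have "v a \<le> v t1" using v t1(1) that by (auto simp: monotone_on_def)
    moreover have "Inf (v ` {0..}) \<le> v (a + h)"
      using bdd t1(1) that \<open>0 \<le> h\<close> by (intro cInf_lower) auto
    ultimately show ?thesis using t1(2) by linarith
  qed
  then show ?thesis using t1(1) by blast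
qed

text \<open>Attractivity in \<open>GAS\<close> is not uniform over the family, so one trajectory is
  treated at a time, with dwell time \<tau> and visiting time \<open>T\<close> depending on its
  signal.\<close>

lemma trajectory_tendsto_0:
  fixes A P :: "'g \<Rightarrow> real^'n^'n"
  assumes fin: "finite \<Gamma>"
    and f: "\<And>\<gamma> \<xi>. \<gamma> \<in> \<Gamma> \<Longrightarrow> f \<xi> \<gamma> = A \<gamma> *v \<xi>"
    and traj: "(I, x, \<sigma>) \<in> trajectories \<Gamma> f" and I: "{0..} \<subseteq> I"
    and Sd: "\<sigma> \<in> S_d \<Gamma>" and Se: "\<sigma> \<in> S_e \<Gamma>"
    and P: "\<And>\<gamma>. \<gamma> \<in> \<Gamma> \<Longrightarrow> positive_definite (P \<gamma>)"
    and lyap: "\<And>\<gamma>. \<gamma> \<in> \<Gamma> \<Longrightarrow> P \<gamma> ** A \<gamma> + transpose (A \<gamma>) ** P \<gamma> \<preceq> - gram (C \<gamma>)"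
    and v: "antimono_on {0..} (\<lambda>t. x t \<bullet> (P (\<sigma> t) *v x t))"
    and unobs: "\<And>\<gamma>. \<gamma> \<in> \<Gamma> \<Longrightarrow> unobservable_subspace (C \<gamma>) (A \<gamma>) \<subseteq> ker (A \<gamma>)"
    and ker: "(\<Inter>\<gamma>\<in>\<Gamma>. ker (A \<gamma>)) \<subseteq> {0}"
  shows "(x \<longlongrightarrow> 0) at_top"
proof -
  obtain \<tau> where \<tau>: "\<tau> > 0" "\<sigma> \<in> dwell_time_signals \<Gamma> \<tau>" using Sd by (auto simp: S_d_def)
  obtain T where T: "T > 0" "\<sigma> \<in> ergodic_signals \<Gamma> T" using Se by (auto simp: S_e_def)
  define h where "h = \<tau> / 3"
  have h: "h > 0" "3 * h \<le> \<tau>" using \<tau> by (auto simp: h_def)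
  have \<sigma>\<Gamma>: "\<sigma> t \<in> \<Gamma>" for t
    using traj by (auto simp: trajectories_def switching_signals_def)
  have ac: "abs_cont_on {a..b} x" if "0 \<le> a" for a b
  proof -
    have "{a..b} \<subseteq> I" using I that by auto
    then show ?thesis using traj by (auto simp: trajectories_def locally_abs_cont_on_def)
  qed
  have "AE t in lebesgue. t \<in> I \<longrightarrow> (x has_vector_derivative f (x t) (\<sigma> t)) (at t within I)"
    using traj by (simp add: trajectories_def)
  then obtain N where N: "negligible N"
    "\<And>t. t \<in> I \<Longrightarrow> t \<notin> N \<Longrightarrow> (x has_vector_derivative f (x t) (\<sigma> t)) (at t within I)"
    unfolding eventually_ae_filter negligible_iff_null_sets by auto
  have x': "(x has_vector_derivative A (\<sigma> t) *v x t) (at t within {a..b})"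
    if "0 \<le> a" "t \<in> {a..b}" "t \<notin> N" for a b t
  proof -
    have sub: "{a..b} \<subseteq> I" using I that by auto
    then have "t \<in> I" using that(2) by blast
    from has_vector_derivative_within_subset[OF N(2)[OF this that(3)] sub]
    show ?thesis by (simp add: f[OF \<sigma>\<Gamma>])
  qed
  have "\<forall>\<gamma>\<in>\<Gamma>. \<exists>K\<ge>0. \<forall>a y. linear_ode_on {a..a + h} (A \<gamma>) y \<longrightarrow> (\<forall>t\<in>{a..a + h}.
      (norm (A \<gamma> *v y t))\<^sup>2 \<le> K * (y a \<bullet> (P \<gamma> *v y a) - y (a + h) \<bullet> (P \<gamma> *v y (a + h))))"
    using lyapunov_drop_bound[OF lyap unobs h(1)] by blast
  then obtain K where K: "\<And>\<gamma>. \<gamma> \<in> \<Gamma> \<Longrightarrow> K \<gamma> \<ge> 0"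
    "\<And>\<gamma> a y t. \<gamma> \<in> \<Gamma> \<Longrightarrow> linear_ode_on {a..a + h} (A \<gamma>) y \<Longrightarrow> t \<in> {a..a + h} \<Longrightarrow>
      (norm (A \<gamma> *v y t))\<^sup>2 \<le> K \<gamma> * (y a \<bullet> (P \<gamma> *v y a) - y (a + h) \<bullet> (P \<gamma> *v y (a + h)))"
    unfolding bchoice_iff by (elim exE) (rule that; blast)
  define v where "v t = x t \<bullet> (P (\<sigma> t) *v x t)" for t
  have v_mono: "antimono_on {0..} v" using v by (simp add: v_def[abs_def])
  have v_nonneg: "0 \<le> v t" for t
    using P[OF \<sigma>\<Gamma>[of t]] by (cases "x t = 0") (auto simp: v_def positive_definite_def intro: less_imp_le)
  have decay: "\<exists>t1\<ge>0. \<forall>t\<ge>t1. norm (A (\<sigma> t) *v x t) \<le> e" if "e > 0" for e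
  proof -
    \<comment> \<open>One constant for all modes; adding 1 makes it positive, so that it can be
      divided by.\<close>
    define K0 where "K0 = sum K \<Gamma> + 1"
    have K0: "K0 > 0" "\<And>\<gamma>. \<gamma> \<in> \<Gamma> \<Longrightarrow> K \<gamma> \<le> K0"
      using K(1) fin member_le_sum[of _ \<Gamma> K] sum_nonneg[of \<Gamma> K] by (fastforce simp: K0_def)+
    obtain t1 where t1: "t1 \<ge> 0" "\<And>a. a \<ge> t1 \<Longrightarrow> v a - v (a + h) < e\<^sup>2 / K0"
      using antimono_nonneg_drop[OF v_mono v_nonneg, of h "e\<^sup>2 / K0"] h K0 \<open>e > 0\<close> by auto
    \<comment> \<open>The constancy interval around \<open>t\<close> may start up to
      \<open>h\<close> earlier, and its start must not precede \<open>t1\<close>.\<close>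
    have "norm (A (\<sigma> t) *v x t) \<le> e" if "t1 + h \<le> t" for t
    proof -
      obtain a where a: "a \<le> t" "t \<le> a + h" "\<And>s. s \<in> {a..a + h} \<Longrightarrow> \<sigma> s = \<sigma> t"
        using dwell_time_constant_interval[OF \<tau>(2) h, of t] by blast
      have "0 \<le> a" "t1 \<le> a" using a(2) that t1(1) by auto
      have "linear_ode_on {a..a + h} (A (\<sigma> t)) x"
        using x'[OF \<open>0 \<le> a\<close>] a(3) by (intro abs_cont_ode_imp_classical[OF ac[OF \<open>0 \<le> a\<close>] N(1)]) metis
      then have "(norm (A (\<sigma> t) *v x t))\<^sup>2
          \<le> K (\<sigma> t) * (x a \<bullet> (P (\<sigma> t) *v x a) - x (a + h) \<bullet> (P (\<sigma> t) *v x (a + h)))"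
        using a(1,2) by (intro K(2) \<sigma>\<Gamma>) auto
      \<comment> \<open>The mode is the same at both closed ends, so the form of
        \<open>P (\<sigma> t)\<close> agrees there with \<open>v\<close>.\<close>
      also have "\<dots> = K (\<sigma> t) * (v a - v (a + h))"
        using a(3)[of a] a(3)[of "a + h"] h by (simp add: v_def)
      also have "\<dots> \<le> K0 * (v a - v (a + h))"
      proof (rule mult_right_mono[OF K0(2)[OF \<sigma>\<Gamma>]])
        have "v (a + h) \<le> v a" using v_mono \<open>0 \<le> a\<close> h by (auto simp: monotone_on_def)
        then show "0 \<le> v a - v (a + h)" by simp
      qed
      also have "\<dots> \<le> K0 * (e\<^sup>2 / K0)"
        using t1(2)[OF \<open>t1 \<le> a\<close>] K0(1) by (intro mult_left_mono) auto
      also have "\<dots> = e\<^sup>2" using K0(1) by simp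
      finally show ?thesis using \<open>e > 0\<close> by (rule power2_le_imp_le[OF _ less_imp_le])
    qed
    then show ?thesis using t1(1) h by (intro exI[of _ "t1 + h"]) auto
  qed
  have modes: "((\<lambda>t. A \<gamma> *v x t) \<longlongrightarrow> 0) at_top" if \<gamma>: "\<gamma> \<in> \<Gamma>" for \<gamma>
  proof (rule tendstoI)
    fix e :: real assume "e > 0"
    obtain L where L: "L > 0" "\<And>x. norm (A \<gamma> *v x) \<le> L * norm x"
      using linear_bounded_pos[OF matrix_vector_mul_linear[of "A \<gamma>"]] by blast
    \<comment> \<open>Chosen so that \<open>d + L * (d * T)\<close>, the final bound on
      \<open>A \<gamma> *v x t\<close>, equals \<open>e / 2\<close>.\<close>
    define d where "d = e / 2 / (1 + L * T)"
    have d: "d > 0" "d + L * (d * T) < e"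
    proof -
      have LT: "1 + L * T > 0" using L T by (simp add: add_pos_pos)
      then show "d > 0" using \<open>e > 0\<close> by (simp add: d_def)
      have "d + L * (d * T) = d * (1 + L * T)" by (simp add: algebra_simps)
      also have "\<dots> = e / 2" using d_def LT by (metis less_irrefl nonzero_eq_divide_eq)
      finally show "d + L * (d * T) < e" using \<open>e > 0\<close> by simp
    qed
    obtain t1 where t1: "t1 \<ge> 0" "\<And>t. t \<ge> t1 \<Longrightarrow> norm (A (\<sigma> t) *v x t) \<le> d"
      using decay[OF d(1)] by blast
    have "norm (A \<gamma> *v x t) < e" if t: "t1 \<le> t" for t
    proof -
      have "0 \<le> t" using t t1(1) by simp
      then have "\<sigma> -` {\<gamma>} \<inter> {t..t + T} \<noteq> {}"
        using T(2) \<gamma> unfolding ergodic_signals_def by blast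
      then obtain s where s: "s \<in> {t..t + T}" "\<sigma> s = \<gamma>" by blast
      \<comment> \<open>With \<open>c = 0\<close> the derivative bound becomes a mean value
        inequality for the displacement.\<close>
      have "norm (x s - x t - (s - t) *\<^sub>R 0) \<le> d * (s - t)"
      proof (rule abs_cont_on_deriv_bound[OF ac[OF \<open>0 \<le> t\<close>] _ N(1) x'[OF \<open>0 \<le> t\<close>]])
        show "norm (A (\<sigma> u) *v x u - 0) \<le> d" if "u \<in> {t..s}" for u
          using t1(2)[of u] that t by simp
      qed (use s d in auto)
      also have "\<dots> \<le> d * T" using s d by (intro mult_left_mono) auto
      finally have xs: "norm (x t - x s) \<le> d * T" by (simp add: norm_minus_commute)
      \<comment> \<open>Mode \<gamma> is active at \<open>s\<close>, so the first summand is the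
        small quantity controlled by \<open>decay\<close>.\<close>
      have "A \<gamma> *v x t = A (\<sigma> s) *v x s + A \<gamma> *v (x t - x s)"
        by (simp add: s(2) matrix_vector_mult_diff_distrib)
      also have "norm \<dots> \<le> d + L * (d * T)"
      proof (rule norm_triangle_le[OF add_mono])
        show "norm (A (\<sigma> s) *v x s) \<le> d" using t1(2)[of s] s t by simp
        show "norm (A \<gamma> *v (x t - x s)) \<le> L * (d * T)"
          using order.trans[OF L(2) mult_left_mono[OF xs]] L(1) by simp
      qed
      finally show ?thesis using d(2) by simp
    qed
    then show "\<forall>\<^sub>F t in at_top. dist (A \<gamma> *v x t) 0 < e"
      by (auto simp: eventually_at_top_linorder)
  qed
  \<comment> \<open>The null space of this form is the intersection of the kernels, hence trivial,
    so the form dominates the square of the norm.\<close>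
  define g where "g \<xi> = (\<Sum>\<gamma>\<in>\<Gamma>. transpose (A \<gamma>) *v (A \<gamma> *v \<xi>))" for \<xi>
  have gq: "\<xi> \<bullet> g \<xi> = (\<Sum>\<gamma>\<in>\<Gamma>. (norm (A \<gamma> *v \<xi>))\<^sup>2)" for \<xi>
    by (simp add: g_def inner_sum_right power2_norm_eq_inner dot_lmul_matrix inner_commute[of \<xi>])
  have "linear g"
    unfolding g_def
    using linear_compose[OF matrix_vector_mul_linear matrix_vector_mul_linear]
    by (intro linear_compose_sum) (auto simp: o_def simp del: transpose_matrix_vector)
  have "\<exists>K\<ge>0. \<forall>\<xi>. (norm \<xi>)\<^sup>2 \<le> K * (\<xi> \<bullet> g \<xi>)"
  proof (rule psd_form_dominates[OF \<open>linear g\<close> linear_ident])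
    show "0 \<le> \<xi> \<bullet> g \<xi>" for \<xi> by (simp add: gq sum_nonneg)
    show "\<xi> = 0" if "\<xi> \<bullet> g \<xi> = 0" for \<xi>
      using that ker fin by (auto simp: gq sum_nonneg_eq_0_iff ker_def)
  qed
  then obtain M where M: "\<And>\<xi>. (norm \<xi>)\<^sup>2 \<le> M * (\<xi> \<bullet> g \<xi>)" by blast
  have "((\<lambda>t. M * (\<Sum>\<gamma>\<in>\<Gamma>. (norm (A \<gamma> *v x t))\<^sup>2)) \<longlongrightarrow> M * (\<Sum>\<gamma>\<in>\<Gamma>. (norm (0::real^'n))\<^sup>2)) at_top"
    by (intro tendsto_intros modes)
  then have lim: "((\<lambda>t. M * (\<Sum>\<gamma>\<in>\<Gamma>. (norm (A \<gamma> *v x t))\<^sup>2)) \<longlongrightarrow> 0) at_top" by simp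
  have "((\<lambda>t. (norm (x t))\<^sup>2) \<longlongrightarrow> 0) at_top"
  proof (rule tendsto_sandwich[OF _ _ tendsto_const lim])
    show "\<forall>\<^sub>F t in at_top. (norm (x t))\<^sup>2 \<le> M * (\<Sum>\<gamma>\<in>\<Gamma>. (norm (A \<gamma> *v x t))\<^sup>2)"
      using M by (simp add: gq)
  qed simp
  from tendsto_real_sqrt[OF this] show ?thesis
    by (simp add: tendsto_norm_zero_iff)
qed

theorem corollary4p1:
  fixes \<Gamma> :: "'g set"
    and f :: "real^'n \<Rightarrow> 'g \<Rightarrow> real^'n"
    and A P :: "'g \<Rightarrow> real^'n^'n"
    and C :: "'g \<Rightarrow> 'n row_matrix"
    and \<T> :: "('n, 'g) traj set"
  assumes "finite \<Gamma>"
    and "\<And>\<gamma> \<xi>. \<gamma> \<in> \<Gamma> \<Longrightarrow> f \<xi> \<gamma> = A \<gamma> *v \<xi>"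
    and "\<T> \<subseteq> trajectories \<Gamma> f"
    and "\<And>\<theta>. \<theta> \<in> \<T> \<Longrightarrow> forward_complete \<theta>"
    and "\<And>I x \<sigma>. (I, x, \<sigma>) \<in> \<T> \<Longrightarrow> \<sigma> \<in> S_d \<Gamma> \<inter> S_e \<Gamma>"
    and "\<And>\<gamma>. \<gamma> \<in> \<Gamma> \<Longrightarrow> positive_definite (P \<gamma>)"
    and "\<And>\<gamma>. \<gamma> \<in> \<Gamma> \<Longrightarrow> P \<gamma> ** A \<gamma> + transpose (A \<gamma>) ** P \<gamma> \<preceq> - gram (C \<gamma>)"
    and "\<And>I x \<sigma>. (I, x, \<sigma>) \<in> \<T> \<Longrightarrow> antimono_on {0..} (\<lambda>t. x t \<bullet> (P (\<sigma> t) *v x t))"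
    and "\<And>\<gamma>. \<gamma> \<in> \<Gamma> \<Longrightarrow> unobservable_subspace (C \<gamma>) (A \<gamma>) = ker (A \<gamma>)"
    and "(\<Inter>\<gamma>\<in>\<Gamma>. ker (A \<gamma>)) = {0}"
  shows "GAS \<T>"
proof -
  have "\<forall>\<gamma>\<in>\<Gamma>. \<exists>c. \<exists>C. 0 < c \<and> 0 < C \<and>
      (\<forall>\<xi>. c * (norm \<xi>)\<^sup>2 \<le> \<xi> \<bullet> (P \<gamma> *v \<xi>) \<and> \<xi> \<bullet> (P \<gamma> *v \<xi>) \<le> C * (norm \<xi>)\<^sup>2)"
    using positive_definite_bounds[OF assms(6)] by blast
  from bchoice[OF this] obtain c where "\<forall>\<gamma>\<in>\<Gamma>. \<exists>C. 0 < c \<gamma> \<and> 0 < C \<and>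
      (\<forall>\<xi>. c \<gamma> * (norm \<xi>)\<^sup>2 \<le> \<xi> \<bullet> (P \<gamma> *v \<xi>) \<and> \<xi> \<bullet> (P \<gamma> *v \<xi>) \<le> C * (norm \<xi>)\<^sup>2)" ..
  from bchoice[OF this] obtain d where "\<forall>\<gamma>\<in>\<Gamma>. 0 < c \<gamma> \<and> 0 < d \<gamma> \<and>
      (\<forall>\<xi>. c \<gamma> * (norm \<xi>)\<^sup>2 \<le> \<xi> \<bullet> (P \<gamma> *v \<xi>) \<and> \<xi> \<bullet> (P \<gamma> *v \<xi>) \<le> d \<gamma> * (norm \<xi>)\<^sup>2)" ..
  note cd = bspec[OF this]
  \<comment> \<open>Bounds uniform over the finitely many modes; inserting 1 keeps both sets
    nonempty and gives \<open>d0\<close> a positive lower bound.\<close>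
  define c0 d0 where "c0 = Min (insert 1 (c ` \<Gamma>))" and "d0 = Max (insert 1 (d ` \<Gamma>))"
  have c0: "c0 > 0" "\<And>\<gamma>. \<gamma> \<in> \<Gamma> \<Longrightarrow> c0 \<le> c \<gamma>"
    using assms(1) cd by (auto simp: c0_def)
  have d0: "d0 \<ge> 1" "\<And>\<gamma>. \<gamma> \<in> \<Gamma> \<Longrightarrow> d \<gamma> \<le> d0"
    using assms(1) by (auto simp: d0_def)
  have lower: "c0 * (norm \<xi>)\<^sup>2 \<le> \<xi> \<bullet> (P \<gamma> *v \<xi>)" if "\<gamma> \<in> \<Gamma>" for \<gamma> \<xi>
    using cd[OF that] c0(2)[OF that] by (meson mult_right_mono order.trans zero_le_power2)
  have upper: "\<xi> \<bullet> (P \<gamma> *v \<xi>) \<le> d0 * (norm \<xi>)\<^sup>2" if "\<gamma> \<in> \<Gamma>" for \<gamma> \<xi>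
    using cd[OF that] d0(2)[OF that] by (meson mult_right_mono order.trans zero_le_power2)
  \<comment> \<open>The value of the Lyapunov function at \<open>t\<close> is at most that at
    \<open>t0\<close>, whichever modes are active; comparing both with the norm produces the factor
    \<open>d0 / c0\<close>, the same for the whole family, so \<alpha> can be taken linear.\<close>
  have bound: "norm (x t) \<le> sqrt (d0 / c0) * norm (x t0)"
    if traj: "(I, x, \<sigma>) \<in> \<T>" and t: "0 \<le> t0" "t0 \<le> t" for I x \<sigma> t0 t
  proof -
    have "(I, x, \<sigma>) \<in> trajectories \<Gamma> f" using assms(3) traj by blast
    then have \<sigma>: "\<sigma> s \<in> \<Gamma>" for s
      by (auto simp: trajectories_def switching_signals_def)
    have "c0 * (norm (x t))\<^sup>2 \<le> x t \<bullet> (P (\<sigma> t) *v x t)" by (rule lower[OF \<sigma>])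
    also have "\<dots> \<le> x t0 \<bullet> (P (\<sigma> t0) *v x t0)"
      using assms(8)[OF traj] t by (auto simp: monotone_on_def)
    also have "\<dots> \<le> d0 * (norm (x t0))\<^sup>2" by (rule upper[OF \<sigma>])
    finally have "(norm (x t))\<^sup>2 \<le> d0 / c0 * (norm (x t0))\<^sup>2"
      using c0(1) by (simp add: field_simps)
    then have "sqrt ((norm (x t))\<^sup>2) \<le> sqrt (d0 / c0 * (norm (x t0))\<^sup>2)"
      by (rule real_sqrt_le_mono)
    then show ?thesis by (simp only: real_sqrt_mult real_sqrt_abs abs_norm_cancel)
  qed
  have limit: "(x \<longlongrightarrow> 0) at_top" if traj: "(I, x, \<sigma>) \<in> \<T>" for I x \<sigma>
  proof (rule trajectory_tendsto_0[where \<Gamma> = \<Gamma> and f = f and A = A and P = P and C = C and I = I and \<sigma> = \<sigma>])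
    show "(I, x, \<sigma>) \<in> trajectories \<Gamma> f" using traj assms(3) by blast
    show "{0..} \<subseteq> I" using assms(4)[OF traj] by (simp add: forward_complete_def)
  qed (use assms traj in auto)
  show ?thesis
    unfolding GAS_def
  proof (intro conjI exI[of _ "\<lambda>r. sqrt (d0 / c0) * r"])
    show "class_K_inf (\<lambda>r. sqrt (d0 / c0) * r)"
      using c0(1) d0(1) by (intro class_K_inf_linear) auto
  qed (use bound limit in auto)
qed

end
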